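(* Let $\mathcal{M}$ be a commutative von Neumann algebra equipped with a faithful normal semifinite trace $\tau$, and let $\mathbb{E}$ be a Banach $\mathcal{M}$-bimodule of $\tau$-compact operators. Then any derivation $\delta:\mathcal{M}\to\mathbb{E}$ vanishes, i.e. $\delta=0$.
   Context: $\mathcal{M}$ acts on a Hilbert space $H$. A linear operator $x$ with domain in $H$ is affiliated with $\mathcal{M}$ if $yx\subseteq xy$ for all $y$ in the commutant $\mathcal{M}'$. A closed densely defined operator $x$ affiliated with $\mathcal{M}$ is $\tau$-measurable if $\tau(e^{|x|}(\lambda,\infty))<\infty$ for some $\lambda>0$, where $e^{|x|}$ is the spectral measure of $|x|$. The set $S(\tau)$ of $\tau$-measurable operators is a $*$-algebra under strong sum and strong product. For $x\in S(\tau)$ put $\mu(t;x)=\inf\{s\ge 0:\tau(e^{|x|}(s,\infty))\le t\}$, $t\ge 0$. The set of $\tau$-compact operators is $S_0(\tau)=\{x\in S(\tau):\lim_{t\to\infty}\mu(t;x)=0\}$. A Banach $\mathcal{M}$-bimodule is a linear subspace $\mathbb{E}$ of $S(\tau)$ with a norm $\|\cdot\|_{\mathbb{E}}$ such that $(\mathbb{E},\|\cdot\|_{\mathbb{E}})$ is a Banach space and, whenever $x\in\mathbb{E}$ and $u,v\in\mathcal{M}$, one has $uxv\in\mathbb{E}$ and $\|uxv\|_{\mathbb{E}}\le\|u\|_{\mathcal{B}(H)}\|v\|_{\mathcal{B}(H)}\|x\|_{\mathbb{E}}$. It is a Banach bimodule of $\tau$-compact operators if moreover $\mathbb{E}\subseteq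 S_0(\tau)$. A derivation from an algebra $A$ into an $A$-bimodule $\mathbb{E}$ is a linear map $\delta:A\to\mathbb{E}$ with $\delta(xy)=\delta(x)y+x\delta(y)$ for all $x,y\in A$. No continuity is assumed. *)

theory Defs
  imports "HOL-Analysis.Analysis"
begin

section \<open>Complex Hilbert spaces and bounded operators\<close>

text \<open>The inner product is conjugate linear in its first argument. The last axiom contains
  positive definiteness and says that the norm of the Banach space is the one induced by the
  inner product.\<close>

class chilbert_space = banach +
  fixes scaleC :: "complex \<Rightarrow> 'a \<Rightarrow> 'a" (infixr "*\<^sub>C" 75)
    and cinner :: "'a \<Rightarrow> 'a \<Rightarrow> complex"
  assumes scaleC_add_right: "c *\<^sub>C (x + y) = c *\<^sub>C x + c *\<^sub>C y"
    and scaleC_add_left: "(c + d) *\<^sub>C x = c *\<^sub>C x + d *\<^sub>C x"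
    and scaleC_scaleC: "c *\<^sub>C (d *\<^sub>C x) = (c * d) *\<^sub>C x"
    and scaleC_of_real: "complex_of_real r *\<^sub>C x = r *\<^sub>R x"
    and cinner_commute: "cinner x y = cnj (cinner y x)"
    and cinner_add_left: "cinner (x + y) z = cinner x z + cinner y z"
    and cinner_scaleC_left: "cinner (c *\<^sub>C x) y = cnj c * cinner x y"
    and cinner_self: "cinner x x = complex_of_real ((norm x)\<^sup>2)"

lemma norm_scaleC: "norm (c *\<^sub>C (x :: 'a::chilbert_space)) = cmod c * norm x"
proof -
  have "cinner (c *\<^sub>C x) (c *\<^sub>C x) = cnj c * cnj (cinner (c *\<^sub>C x) x)"
    by (metis cinner_commute cinner_scaleC_left)
  also have "\<dots> = (cnj c * c) * complex_of_real ((norm x)\<^sup>2)"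
    by (simp add: cinner_scaleC_left cinner_self)
  also have "\<dots> = complex_of_real ((cmod c * norm x)\<^sup>2)"
    by (simp add: power_mult_distrib mult.commute[of "cnj c"] flip: complex_norm_square)
  finally have "(norm (c *\<^sub>C x))\<^sup>2 = (cmod c * norm x)\<^sup>2"
    unfolding cinner_self of_real_eq_iff .
  then show ?thesis
    by (simp add: power2_eq_iff_nonneg)
qed

lemma scaleC_scaleR_commute: "c *\<^sub>C (r *\<^sub>R x) = r *\<^sub>R (c *\<^sub>C (x :: 'a::chilbert_space))"
  by (simp add: scaleC_scaleC mult.commute flip: scaleC_of_real)

text \<open>The library type of bounded operators is real linear, so \<open>B(H)\<close> is the subset of the
  complex linear ones.\<close>

definition bounded_ops :: "('a::chilbert_space \<Rightarrow>\<^sub>L 'a) set" where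
  "bounded_ops = {u. \<forall>c v. blinfun_apply u (c *\<^sub>C v) = c *\<^sub>C blinfun_apply u v}"

lift_definition scaleC_blinfun ::
    "complex \<Rightarrow> ('a::chilbert_space \<Rightarrow>\<^sub>L 'a) \<Rightarrow> ('a \<Rightarrow>\<^sub>L 'a)"
  is "\<lambda>c u v. c *\<^sub>C u v"
proof -
  fix c :: complex and u :: "'a \<Rightarrow> 'a"
  assume u: "bounded_linear u"
  have "bounded_linear (\<lambda>v::'a. c *\<^sub>C v)"
    by (rule bounded_linear_intro[where K = "cmod c"])
      (simp_all add: scaleC_add_right scaleC_scaleR_commute norm_scaleC mult.commute)
  from bounded_linear_compose[OF this u] show "bounded_linear (\<lambda>v. c *\<^sub>C u v)" .
qed

definition is_adjoint :: "('a::chilbert_space \<Rightarrow>\<^sub>L 'a) \<Rightarrow> ('a \<Rightarrow>\<^sub>L 'a) \<Rightarrow> bool" where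
  "is_adjoint u w \<longleftrightarrow>
     (\<forall>x y. cinner (blinfun_apply u x) y = cinner x (blinfun_apply w y))"

definition op_le :: "('a::chilbert_space \<Rightarrow>\<^sub>L 'a) \<Rightarrow> ('a \<Rightarrow>\<^sub>L 'a) \<Rightarrow> bool" where
  "op_le u w \<longleftrightarrow> (\<forall>v. cinner v (blinfun_apply (w - u) v) \<in> \<real>\<^sub>\<ge>\<^sub>0)"

definition is_projection :: "('a::chilbert_space \<Rightarrow>\<^sub>L 'a) \<Rightarrow> bool" where
  "is_projection p \<longleftrightarrow> p \<in> bounded_ops \<and> p o\<^sub>L p = p \<and> is_adjoint p p"


section \<open>Von Neumann algebras and traces\<close>

definition commutant :: "('a::chilbert_space \<Rightarrow>\<^sub>L 'a) set \<Rightarrow> ('a \<Rightarrow>\<^sub>L 'a) set" where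
  "commutant S = {u \<in> bounded_ops. \<forall>s\<in>S. u o\<^sub>L s = s o\<^sub>L u}"

text \<open>The bicommutant condition makes \<open>M\<close> a weakly closed unital algebra of complex linear
  bounded operators.\<close>

definition von_neumann_algebra :: "('a::chilbert_space \<Rightarrow>\<^sub>L 'a) set \<Rightarrow> bool" where
  "von_neumann_algebra M \<longleftrightarrow>
     (\<forall>u\<in>M. \<exists>w\<in>M. is_adjoint u w) \<and> commutant (commutant M) = M"

definition commutative_ops :: "('a::chilbert_space \<Rightarrow>\<^sub>L 'a) set \<Rightarrow> bool" where
  "commutative_ops M \<longleftrightarrow> (\<forall>u\<in>M. \<forall>w\<in>M. u o\<^sub>L w = w o\<^sub>L u)"

definition positive_part :: "('a::chilbert_space \<Rightarrow>\<^sub>L 'a) set \<Rightarrow> ('a \<Rightarrow>\<^sub>L 'a) set" where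
  "positive_part M = {u \<in> M. op_le 0 u}"

text \<open>A trace is a function on the positive part with values in \<open>[0, \<infinity>]\<close>; its values outside the
  positive part carry no meaning.\<close>

definition trace_on ::
    "('a::chilbert_space \<Rightarrow>\<^sub>L 'a) set \<Rightarrow> (('a \<Rightarrow>\<^sub>L 'a) \<Rightarrow> ennreal) \<Rightarrow> bool" where
  "trace_on M \<tau> \<longleftrightarrow>
     (\<forall>u\<in>positive_part M. \<forall>w\<in>positive_part M. \<tau> (u + w) = \<tau> u + \<tau> w) \<and>
     (\<forall>u\<in>positive_part M. \<forall>r\<ge>0. \<tau> (r *\<^sub>R u) = ennreal r * \<tau> u) \<and>
     (\<forall>u\<in>M. \<forall>w\<in>M. is_adjoint u w \<longrightarrow> \<tau> (w o\<^sub>L u) = \<tau> (u o\<^sub>L w))"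

definition faithful_on ::
    "('a::chilbert_space \<Rightarrow>\<^sub>L 'a) set \<Rightarrow> (('a \<Rightarrow>\<^sub>L 'a) \<Rightarrow> ennreal) \<Rightarrow> bool" where
  "faithful_on M \<tau> \<longleftrightarrow> (\<forall>u\<in>positive_part M. \<tau> u = 0 \<longrightarrow> u = 0)"

definition is_lub_in ::
    "('a::chilbert_space \<Rightarrow>\<^sub>L 'a) set \<Rightarrow> ('a \<Rightarrow>\<^sub>L 'a) set \<Rightarrow> ('a \<Rightarrow>\<^sub>L 'a) \<Rightarrow> bool" where
  "is_lub_in P D u \<longleftrightarrow>
     u \<in> P \<and> (\<forall>d\<in>D. op_le d u) \<and> (\<forall>w\<in>P. (\<forall>d\<in>D. op_le d w) \<longrightarrow> op_le u w)"

text \<open>Increasing nets are represented by their ranges, which are upward directed sets.\<close>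

definition normal_on ::
    "('a::chilbert_space \<Rightarrow>\<^sub>L 'a) set \<Rightarrow> (('a \<Rightarrow>\<^sub>L 'a) \<Rightarrow> ennreal) \<Rightarrow> bool" where
  "normal_on M \<tau> \<longleftrightarrow>
     (\<forall>D u. D \<subseteq> positive_part M \<and> D \<noteq> {} \<and>
        (\<forall>d\<in>D. \<forall>e\<in>D. \<exists>f\<in>D. op_le d f \<and> op_le e f) \<and>
        is_lub_in (positive_part M) D u \<longrightarrow>
        \<tau> u = (SUP d\<in>D. \<tau> d))"

definition semifinite_on ::
    "('a::chilbert_space \<Rightarrow>\<^sub>L 'a) set \<Rightarrow> (('a \<Rightarrow>\<^sub>L 'a) \<Rightarrow> ennreal) \<Rightarrow> bool" where
  "semifinite_on M \<tau> \<longleftrightarrow>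
     (\<forall>u\<in>positive_part M. u \<noteq> 0 \<longrightarrow>
        (\<exists>w\<in>positive_part M. w \<noteq> 0 \<and> op_le w u \<and> \<tau> w < \<infinity>))"


section \<open>Unbounded operators\<close>

text \<open>An operator with domain in \<open>H\<close> is identified with its graph, so that extension of operators
  is set inclusion and closed operators are closed sets. The relational product applies its left
  argument first, hence the reversal in \<open>op_mult\<close>.\<close>

type_synonym 'a operator = "('a \<times> 'a) set"

definition linear_operator :: "'a::chilbert_space operator \<Rightarrow> bool" where
  "linear_operator x \<longleftrightarrow>
     single_valued x \<and> (0, 0) \<in> x \<and>
     (\<forall>p\<in>x. \<forall>q\<in>x. p + q \<in> x) \<and>
     (\<forall>c v w. (v, w) \<in> x \<longrightarrow> (c *\<^sub>C v, c *\<^sub>C w) \<in> x)"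

definition densely_defined :: "'a::chilbert_space operator \<Rightarrow> bool" where
  "densely_defined x \<longleftrightarrow> closure (Domain x) = UNIV"

definition of_bounded :: "('a::chilbert_space \<Rightarrow>\<^sub>L 'a) \<Rightarrow> 'a operator" where
  "of_bounded u = {(v, blinfun_apply u v) | v. True}"

definition op_add :: "'a::chilbert_space operator \<Rightarrow> 'a operator \<Rightarrow> 'a operator" where
  "op_add x y = {(v, w + z) | v w z. (v, w) \<in> x \<and> (v, z) \<in> y}"

definition op_scale :: "complex \<Rightarrow> 'a::chilbert_space operator \<Rightarrow> 'a operator" where
  "op_scale c x = {(v, c *\<^sub>C w) | v w. (v, w) \<in> x}"

definition op_mult :: "'a::chilbert_space operator \<Rightarrow> 'a operator \<Rightarrow> 'a operator" where
  "op_mult x y = y O x"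

definition op_adjoint :: "'a::chilbert_space operator \<Rightarrow> 'a operator" where
  "op_adjoint x = {(v, w). \<forall>(a, b)\<in>x. cinner b v = cinner a w}"

definition strong_add :: "'a::chilbert_space operator \<Rightarrow> 'a operator \<Rightarrow> 'a operator" where
  "strong_add x y = closure (op_add x y)"

text \<open>The closure only matters for \<open>c = 0\<close>, where it extends the zero operator on the domain of
  \<open>x\<close> to the whole space.\<close>

definition strong_scale :: "complex \<Rightarrow> 'a::chilbert_space operator \<Rightarrow> 'a operator" where
  "strong_scale c x = closure (op_scale c x)"

definition strong_mult :: "'a::chilbert_space operator \<Rightarrow> 'a operator \<Rightarrow> 'a operator" where
  "strong_mult x y = closure (op_mult x y)"

definition strong_diff :: "'a::chilbert_space operator \<Rightarrow> 'a operator \<Rightarrow> 'a operator" where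
  "strong_diff x y = strong_add x (strong_scale (- 1) y)"

definition affiliated :: "('a::chilbert_space \<Rightarrow>\<^sub>L 'a) set \<Rightarrow> 'a operator \<Rightarrow> bool" where
  "affiliated M x \<longleftrightarrow>
     (\<forall>y\<in>commutant M. op_mult (of_bounded y) x \<subseteq> op_mult x (of_bounded y))"

definition positive_selfadjoint :: "'a::chilbert_space operator \<Rightarrow> bool" where
  "positive_selfadjoint a \<longleftrightarrow>
     linear_operator a \<and> densely_defined a \<and> op_adjoint a = a \<and>
     (\<forall>(v, w)\<in>a. cinner v w \<in> \<real>\<^sub>\<ge>\<^sub>0)"

text \<open>The modulus \<open>(x\<^sup>* x)\<^sup>1\<^sup>/\<^sup>2\<close> of a closed densely defined operator.\<close>

definition op_abs :: "'a::chilbert_space operator \<Rightarrow> 'a operator" where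
  "op_abs x = (THE a. positive_selfadjoint a \<and> op_mult a a = op_mult (op_adjoint x) x)"


section \<open>Spectral measures\<close>

text \<open>As for measures in the library, the value on non-measurable sets is fixed to be zero; this
  makes the spectral measure of a self-adjoint operator unique as a total function.\<close>

definition projection_valued_measure ::
    "(real set \<Rightarrow> 'a::chilbert_space \<Rightarrow>\<^sub>L 'a) \<Rightarrow> bool" where
  "projection_valued_measure e \<longleftrightarrow>
     (\<forall>A\<in>sets borel. is_projection (e A)) \<and>
     (\<forall>A. A \<notin> sets borel \<longrightarrow> e A = 0) \<and>
     e UNIV = id_blinfun \<and>
     (\<forall>A\<in>sets borel. \<forall>B\<in>sets borel. e (A \<inter> B) = e A o\<^sub>L e B) \<and>
     (\<forall>A. range A \<subseteq> sets borel \<and> disjoint_family A \<longrightarrow>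
        (\<forall>v. (\<lambda>n::nat. blinfun_apply (e (A n)) v) sums blinfun_apply (e (\<Union>n. A n)) v))"

definition scalar_measure ::
    "(real set \<Rightarrow> 'a::chilbert_space \<Rightarrow>\<^sub>L 'a) \<Rightarrow> 'a \<Rightarrow> real measure" where
  "scalar_measure e v =
     measure_of UNIV (sets borel) (\<lambda>A. ennreal (Re (cinner v (blinfun_apply (e A) v))))"

text \<open>\<open>a = \<integral> t de(t)\<close>: the domain of \<open>a\<close> is the set of \<open>v\<close> with
  \<open>\<integral> t\<^sup>2 d\<langle>v, e(t) v\<rangle> < \<infinity>\<close>, and \<open>\<langle>v, a v\<rangle> = \<integral> t d\<langle>v, e(t) v\<rangle>\<close> there. As this domain is a dense
  subspace, the quadratic form determines the operator by polarization.\<close>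

definition is_spectral_measure_of ::
    "(real set \<Rightarrow> 'a::chilbert_space \<Rightarrow>\<^sub>L 'a) \<Rightarrow> 'a operator \<Rightarrow> bool" where
  "is_spectral_measure_of e a \<longleftrightarrow>
     projection_valued_measure e \<and>
     Domain a = {v. (\<integral>\<^sup>+ t. ennreal (t\<^sup>2) \<partial>scalar_measure e v) < \<infinity>} \<and>
     (\<forall>(v, w)\<in>a. cinner v w = complex_of_real (\<integral>t. t \<partial>scalar_measure e v))"

definition spectral_measure ::
    "'a::chilbert_space operator \<Rightarrow> real set \<Rightarrow> 'a \<Rightarrow>\<^sub>L 'a" where
  "spectral_measure a = (THE e. is_spectral_measure_of e a)"


section \<open>Measurable and compact operators with respect to a trace\<close>

definition tau_measurable ::
    "('a::chilbert_space \<Rightarrow>\<^sub>L 'a) set \<Rightarrow> (('a \<Rightarrow>\<^sub>L 'a) \<Rightarrow> ennreal) \<Rightarrow> 'a operator set" where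
  "tau_measurable M \<tau> =
     {x. linear_operator x \<and> closed x \<and> densely_defined x \<and> affiliated M x \<and>
         (\<exists>s>0. \<tau> (spectral_measure (op_abs x) {s<..}) < \<infinity>)}"

text \<open>The singular value function may be infinite at \<open>t = 0\<close>, so it takes values in
  \<open>[0, \<infinity>]\<close>.\<close>

definition singular_value ::
    "(('a::chilbert_space \<Rightarrow>\<^sub>L 'a) \<Rightarrow> ennreal) \<Rightarrow> 'a operator \<Rightarrow> real \<Rightarrow> ennreal" where
  "singular_value \<tau> x t =
     Inf {ennreal s | s. 0 \<le> s \<and> \<tau> (spectral_measure (op_abs x) {s<..}) \<le> ennreal t}"

definition tau_compact ::
    "('a::chilbert_space \<Rightarrow>\<^sub>L 'a) set \<Rightarrow> (('a \<Rightarrow>\<^sub>L 'a) \<Rightarrow> ennreal) \<Rightarrow> 'a operator set" where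
  "tau_compact M \<tau> = {x \<in> tau_measurable M \<tau>. (singular_value \<tau> x \<longlongrightarrow> 0) at_top}"


section \<open>Banach bimodules and derivations\<close>

definition linear_subspace :: "'a::chilbert_space operator set \<Rightarrow> bool" where
  "linear_subspace E \<longleftrightarrow>
     of_bounded 0 \<in> E \<and>
     (\<forall>x\<in>E. \<forall>y\<in>E. strong_add x y \<in> E) \<and>
     (\<forall>c. \<forall>x\<in>E. strong_scale c x \<in> E)"

definition is_norm_on ::
    "'a::chilbert_space operator set \<Rightarrow> ('a operator \<Rightarrow> real) \<Rightarrow> bool" where
  "is_norm_on E N \<longleftrightarrow>
     (\<forall>x\<in>E. 0 \<le> N x) \<and>
     (\<forall>x\<in>E. N x = 0 \<longleftrightarrow> x = of_bounded 0) \<and>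
     (\<forall>c. \<forall>x\<in>E. N (strong_scale c x) = cmod c * N x) \<and>
     (\<forall>x\<in>E. \<forall>y\<in>E. N (strong_add x y) \<le> N x + N y)"

definition norm_complete_on ::
    "'a::chilbert_space operator set \<Rightarrow> ('a operator \<Rightarrow> real) \<Rightarrow> bool" where
  "norm_complete_on E N \<longleftrightarrow>
     (\<forall>X. (\<forall>n::nat. X n \<in> E) \<and>
        (\<forall>\<epsilon>>0. \<exists>K. \<forall>m\<ge>K. \<forall>n\<ge>K. N (strong_diff (X m) (X n)) < \<epsilon>) \<longrightarrow>
        (\<exists>x\<in>E. (\<lambda>n. N (strong_diff (X n) x)) \<longlonglongrightarrow> 0))"

definition banach_bimodule ::
    "('a::chilbert_space \<Rightarrow>\<^sub>L 'a) set \<Rightarrow> (('a \<Rightarrow>\<^sub>L 'a) \<Rightarrow> ennreal) \<Rightarrow>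
     'a operator set \<Rightarrow> ('a operator \<Rightarrow> real) \<Rightarrow> bool" where
  "banach_bimodule M \<tau> E N \<longleftrightarrow>
     E \<subseteq> tau_measurable M \<tau> \<and> linear_subspace E \<and> is_norm_on E N \<and> norm_complete_on E N \<and>
     (\<forall>x\<in>E. \<forall>u\<in>M. \<forall>v\<in>M.
        strong_mult (strong_mult (of_bounded u) x) (of_bounded v) \<in> E \<and>
        N (strong_mult (strong_mult (of_bounded u) x) (of_bounded v)) \<le> norm u * norm v * N x)"

definition banach_bimodule_of_compact ::
    "('a::chilbert_space \<Rightarrow>\<^sub>L 'a) set \<Rightarrow> (('a \<Rightarrow>\<^sub>L 'a) \<Rightarrow> ennreal) \<Rightarrow>
     'a operator set \<Rightarrow> ('a operator \<Rightarrow> real) \<Rightarrow> bool" where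
  "banach_bimodule_of_compact M \<tau> E N \<longleftrightarrow>
     banach_bimodule M \<tau> E N \<and> E \<subseteq> tau_compact M \<tau>"

definition derivation ::
    "('a::chilbert_space \<Rightarrow>\<^sub>L 'a) set \<Rightarrow> 'a operator set \<Rightarrow>
     (('a \<Rightarrow>\<^sub>L 'a) \<Rightarrow> 'a operator) \<Rightarrow> bool" where
  "derivation M E \<delta> \<longleftrightarrow>
     (\<forall>u\<in>M. \<delta> u \<in> E) \<and>
     (\<forall>u\<in>M. \<forall>w\<in>M. \<delta> (u + w) = strong_add (\<delta> u) (\<delta> w)) \<and>
     (\<forall>c. \<forall>u\<in>M. \<delta> (scaleC_blinfun c u) = strong_scale c (\<delta> u)) \<and>
     (\<forall>u\<in>M. \<forall>w\<in>M. \<delta> (u o\<^sub>L w) =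
        strong_add (strong_mult (\<delta> u) (of_bounded w)) (strong_mult (of_bounded u) (\<delta> w)))"

end

theory Submission imports Defs begin

text \<open>Every closed densely defined operator affiliated with a commutative von Neumann algebra \<open>M\<close>
  is a fraction \<open>b\<inverse>c\<close> with \<open>b, c \<in> M\<close> and \<open>b\<close> injective, and over a common denominator the strong
  operations act on the numerators alone. Let \<open>w \<in> M\<close> be unitary and \<open>\<delta>(w) = b\<inverse>c\<close>. If
  infinitely many pairwise disjoint elements of \<open>M\<close> act nontrivially on \<open>c\<close>, a gliding hump built
  from the powers of \<open>w\<close>, where \<open>\<delta>(w\<^sup>k) = k w\<^sup>k\<^sup>-\<^sup>1 \<delta>(w)\<close>, has an image of infinite norm.
  Otherwise, unless \<open>c = 0\<close>, some \<open>a c \<noteq> 0\<close> is indecomposable, so that \<open>w\<close> is a scalar on its range,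
  and the Leibniz rule forces \<open>a c = 0\<close>. Thus \<open>\<delta>\<close> vanishes on unitaries, which span \<open>M\<close>.\<close>

section \<open>Geometry of complex Hilbert spaces\<close>

text \<open>Since \<delta> is not assumed continuous, the infinite sum z, a norm limit in M, cannot
  be differentiated term by term. Multiplication by \<open>f n\<close> first collapses z to the
  single term f_n^2 w^(k+1), and the Leibniz rule is then applied to both forms of this product.
  Every comparison is thus an identity between finitely many values of \<delta>, and finitely many
  values have a common denominator. Unitaries enter because w^k and its inverse are contractions for
  every k, so the factor k + 1 of \<delta>(w^(k+1)) is never damped.

  Disjointness means f g = 0 for arbitrary elements of M, not for projections. What f^2 = f would
  give for projections comes from the absence of nilpotents in M, and the role of minimal
  projections is played by elements a c on which no disjoint pair acts nontrivially on both
  sides.\<close>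

lemma cinner_add_right: "cinner x (y + z) = cinner x y + cinner (x :: 'a::chilbert_space) z"
  by (metis cinner_commute cinner_add_left complex_cnj_add)

lemma cinner_scaleC_right: "cinner x (c *\<^sub>C y) = c * cinner (x :: 'a::chilbert_space) y"
  by (metis cinner_commute cinner_scaleC_left complex_cnj_mult complex_cnj_cnj)

lemma cinner_scaleR_left: "cinner (r *\<^sub>R x) y = r *\<^sub>R cinner (x :: 'a::chilbert_space) y"
  by (simp add: cinner_scaleC_left scaleR_conv_of_real flip: scaleC_of_real)

lemma cinner_scaleR_right: "cinner x (r *\<^sub>R y) = r *\<^sub>R cinner (x :: 'a::chilbert_space) y"
  by (simp add: cinner_scaleC_right scaleR_conv_of_real flip: scaleC_of_real)

lemma cinner_zero_left [simp]: "cinner 0 (y :: 'a::chilbert_space) = 0"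
  using cinner_add_left[of 0 0 y] by simp

lemma cinner_zero_right [simp]: "cinner (y :: 'a::chilbert_space) 0 = 0"
  using cinner_add_right[of y 0 0] by simp

lemma cinner_minus_left: "cinner (- x) (y :: 'a::chilbert_space) = - cinner x y"
  using cinner_scaleR_left[of "-1" x y] by simp

lemma cinner_minus_right: "cinner y (- x) = - cinner (y :: 'a::chilbert_space) x"
  using cinner_scaleR_right[of y "-1" x] by simp

lemma cinner_diff_left: "cinner (x - z) (y :: 'a::chilbert_space) = cinner x y - cinner z y"
  using cinner_add_left[of x "- z" y] by (simp add: cinner_minus_left)

lemma cinner_diff_right: "cinner y (x - z) = cinner (y :: 'a::chilbert_space) x - cinner y z"
  using cinner_add_right[of y x "- z"] by (simp add: cinner_minus_right)

lemmas cinner_simps = cinner_add_left cinner_add_right cinner_diff_left cinner_diff_right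
  cinner_scaleC_left cinner_scaleC_right cinner_minus_left cinner_minus_right

lemma cinner_self_eq_0_iff: "cinner x x = 0 \<longleftrightarrow> (x :: 'a::chilbert_space) = 0"
  by (simp add: cinner_self)

lemma Re_cinner_commute: "Re (cinner x (y :: 'a::chilbert_space)) = Re (cinner y x)"
  by (subst cinner_commute) simp

lemma norm_add_sq: "(norm (x + y :: 'a::chilbert_space))\<^sup>2
    = (norm x)\<^sup>2 + 2 * Re (cinner x y) + (norm y)\<^sup>2"
proof -
  have "complex_of_real ((norm (x + y))\<^sup>2) = cinner (x + y) (x + y)"
    by (simp only: cinner_self)
  then have "(norm (x + y))\<^sup>2 = Re (cinner (x + y) (x + y))"
    by (metis Re_complex_of_real)
  also have "\<dots> = (norm x)\<^sup>2 + 2 * Re (cinner x y) + (norm y)\<^sup>2"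
    using Re_cinner_commute[of x y]
    by (simp add: cinner_simps cinner_self[of x] cinner_self[of y] del: of_real_power)
  finally show ?thesis .
qed

lemma norm_diff_sq: "(norm (x - y :: 'a::chilbert_space))\<^sup>2
    = (norm x)\<^sup>2 - 2 * Re (cinner x y) + (norm y)\<^sup>2"
  using norm_add_sq[of x "- y"] by (simp add: cinner_minus_right)

lemma Re_cinner_le: "Re (cinner x (y :: 'a::chilbert_space)) \<le> norm x * norm y"
proof (cases "norm x = 0 \<or> norm y = 0")
  case False
  have "0 \<le> (norm (norm y *\<^sub>R x - norm x *\<^sub>R y))\<^sup>2"
    by simp
  also have "\<dots> = 2 * (norm x * norm y) * (norm x * norm y - Re (cinner x y))"
    by (simp add: norm_diff_sq cinner_scaleR_left cinner_scaleR_right power_mult_distrib)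
      (simp add: algebra_simps power2_eq_square)
  finally have "0 \<le> 2 * (norm x * norm y) * (norm x * norm y - Re (cinner x y))" .
  moreover have "0 < 2 * (norm x * norm y)" using False by simp
  ultimately show ?thesis by (simp add: zero_le_mult_iff)
qed auto

lemma cauchy_schwarz: "cmod (cinner x y) \<le> norm x * norm (y :: 'a::chilbert_space)"
proof (cases "cinner x y = 0")
  case False
  define c where "c = cnj (cinner x y) / cmod (cinner x y)"
  have c: "cmod c = 1" using False by (simp add: c_def norm_divide)
  have "cinner x (c *\<^sub>C y) = complex_of_real (cmod (cinner x y))"
    using False complex_norm_square[of "cinner x y"]
    by (simp add: cinner_scaleC_right c_def field_simps power2_eq_square)
  then have "cmod (cinner x y) = Re (cinner x (c *\<^sub>C y))" by simp
  also have "\<dots> \<le> norm x * norm (c *\<^sub>C y)" by (rule Re_cinner_le)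
  finally show ?thesis by (simp add: norm_scaleC c)
qed simp

lemma bounded_bilinear_cinner:
  "bounded_bilinear (cinner :: 'a::chilbert_space \<Rightarrow> 'a \<Rightarrow> complex)"
proof
  show "\<exists>K. \<forall>a b. norm (cinner a (b::'a)) \<le> norm a * norm b * K"
    by (rule exI[of _ 1]) (simp add: cauchy_schwarz)
qed (simp_all add: cinner_simps cinner_scaleR_left cinner_scaleR_right)

lemma bounded_linear_scaleC: "bounded_linear (\<lambda>v::'a::chilbert_space. c *\<^sub>C v)"
  by (rule bounded_linear_intro[where K = "cmod c"])
    (simp_all add: scaleC_add_right scaleC_scaleR_commute norm_scaleC mult.commute)

lemmas tendsto_cinner [tendsto_intros] = bounded_bilinear.tendsto[OF bounded_bilinear_cinner]
lemmas continuous_on_cinner [continuous_intros] =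
  bounded_bilinear.continuous_on[OF bounded_bilinear_cinner]
lemmas tendsto_scaleC [tendsto_intros] = bounded_linear.tendsto[OF bounded_linear_scaleC]
lemmas continuous_on_scaleC [continuous_intros] =
  bounded_linear.continuous_on[OF bounded_linear_scaleC]

lemma scaleC_minus1 [simp]: "(- 1) *\<^sub>C (x :: 'a::chilbert_space) = - x"
  using scaleC_of_real[of "-1" x] by simp

lemma scaleC_one [simp]: "1 *\<^sub>C (x :: 'a::chilbert_space) = x"
  using scaleC_of_real[of 1 x] by simp

lemma scaleC_zero_left [simp]: "0 *\<^sub>C (x :: 'a::chilbert_space) = 0"
  using scaleC_of_real[of 0 x] by simp

lemma scaleC_zero_right [simp]: "c *\<^sub>C (0 :: 'a::chilbert_space) = 0"
  using scaleC_add_right[of c 0 "0::'a"] by simp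

lemma scaleC_diff_right: "c *\<^sub>C (x - y) = c *\<^sub>C x - c *\<^sub>C (y :: 'a::chilbert_space)"
  using bounded_linear_scaleC linear_diff bounded_linear.linear by blast

section \<open>Orthogonal projection onto closed subspaces and Riesz representation\<close>

definition complex_subspace :: "'a::chilbert_space set \<Rightarrow> bool" where
  "complex_subspace S \<longleftrightarrow>
     0 \<in> S \<and> (\<forall>x\<in>S. \<forall>y\<in>S. x + y \<in> S) \<and> (\<forall>c. \<forall>x\<in>S. c *\<^sub>C x \<in> S)"

lemma complex_subspace_diff: "complex_subspace S \<Longrightarrow> x \<in> S \<Longrightarrow> y \<in> S \<Longrightarrow> x - y \<in> S"
  unfolding complex_subspace_def by (metis scaleC_minus1 diff_conv_add_uminus)

lemma complex_subspace_closure: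
  assumes "complex_subspace S"
  shows "complex_subspace (closure S)"
  unfolding complex_subspace_def
proof (intro conjI ballI allI)
  show "0 \<in> closure S"
    using assms closure_subset unfolding complex_subspace_def by blast
next
  fix x y assume "x \<in> closure S" "y \<in> closure S"
  then obtain f g where "\<And>n. f n \<in> S" "f \<longlonglongrightarrow> x" "\<And>n. g n \<in> S" "g \<longlonglongrightarrow> y"
    unfolding closure_sequential by blast
  then show "x + y \<in> closure S"
    using assms unfolding complex_subspace_def closure_sequential
    by (intro exI[of _ "\<lambda>n. f n + g n"]) (auto intro: tendsto_add)
next
  fix c x assume "x \<in> closure S"
  then obtain f where "\<And>n. f n \<in> S" "f \<longlonglongrightarrow> x"
    unfolding closure_sequential by blast
  then show "c *\<^sub>C x \<in> closure S"
    using assms unfolding complex_subspace_def closure_sequential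
    by (intro exI[of _ "\<lambda>n. c *\<^sub>C f n"]) (auto intro: tendsto_scaleC)
qed

lemma closest_point_subspace_exists:
  fixes v :: "'a::chilbert_space"
  assumes S: "closed S" "complex_subspace S"
  shows "\<exists>p\<in>S. \<forall>s\<in>S. norm (v - p) \<le> norm (v - s)"
proof -
  define d where "d = Inf ((\<lambda>s. (norm (v - s))\<^sup>2) ` S)"
  have ne: "S \<noteq> {}" using S(2) unfolding complex_subspace_def by blast
  have bdd: "bdd_below ((\<lambda>s. (norm (v - s))\<^sup>2) ` S)" by (rule bdd_belowI[of _ 0]) auto
  have d_le: "d \<le> (norm (v - s))\<^sup>2" if "s \<in> S" for s
    unfolding d_def by (rule cInf_lower[OF _ bdd]) (use that in blast)
  have "\<exists>s\<in>S. (norm (v - s))\<^sup>2 < d + 1 / Suc n" for n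
  proof -
    have "d < d + 1 / Suc n" by simp
    then show ?thesis
      using cInf_less_iff[OF _ bdd, of "d + 1 / Suc n"] ne unfolding d_def by auto
  qed
  then obtain f where fS: "\<And>n. f n \<in> S" and f: "\<And>n. (norm (v - f n))\<^sup>2 < d + 1 / Suc n"
    by metis
  \<comment> \<open>Parallelogram law: the midpoint of two almost minimizing points lies in S, so
    its squared distance to v is at least d, which forces the two points together.\<close>
  have close: "(norm (f m - f n))\<^sup>2 \<le> 2 / Suc m + 2 / Suc n" for m n
  proof -
    have mid: "(1/2) *\<^sub>R (f m + f n) \<in> S"
      using S(2) fS unfolding complex_subspace_def by (metis scaleC_of_real)
    let ?x = "v - f m" and ?y = "v - f n"
    have "(norm (?x - ?y))\<^sup>2 = 2 * (norm ?x)\<^sup>2 + 2 * (norm ?y)\<^sup>2 - (norm (?x + ?y))\<^sup>2"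
      unfolding norm_diff_sq[of ?x ?y] norm_add_sq[of ?x ?y] by simp
    moreover have "?x + ?y = 2 *\<^sub>R (v - (1/2) *\<^sub>R (f m + f n))"
      by (simp add: algebra_simps scaleR_2)
    then have "(norm (?x + ?y))\<^sup>2 = 4 * (norm (v - (1/2) *\<^sub>R (f m + f n)))\<^sup>2"
      by (simp add: power_mult_distrib)
    moreover have "?x - ?y = - (f m - f n)" by simp
    then have "norm (?x - ?y) = norm (f m - f n)" by (simp only: norm_minus_cancel)
    ultimately show ?thesis
      using d_le[OF mid] f[of m] f[of n] by simp
  qed
  have "Cauchy f"
  proof (rule CauchyI)
    fix e :: real assume e: "0 < e"
    obtain K where K: "4 / e\<^sup>2 < real K" using reals_Archimedean2 by blast
    have "norm (f m - f n) < e" if "K \<le> m" "K \<le> n" for m n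
    proof -
      have h: "2 / Suc j < e\<^sup>2 / 2" if "K \<le> j" for j
        using K that e by (simp add: field_simps)
          (smt (verit) mult_less_cancel_left_pos of_nat_mono zero_less_power mult_right_mono)
      have "(norm (f m - f n))\<^sup>2 < e\<^sup>2"
        using close[of m n] h[OF that(1)] h[OF that(2)] by simp
      then show ?thesis using e by (simp add: power2_less_imp_less)
    qed
    then show "\<exists>K. \<forall>m\<ge>K. \<forall>n\<ge>K. norm (f m - f n) < e" by blast
  qed
  then obtain p where p: "f \<longlonglongrightarrow> p"
    using Cauchy_convergent convergent_def by blast
  have "p \<in> S" using S(1) fS p closed_sequentially by blast
  moreover have "norm (v - p) \<le> norm (v - s)" if "s \<in> S" for s
  proof -
    have "(\<lambda>n. (norm (v - f n))\<^sup>2) \<longlonglongrightarrow> (norm (v - p))\<^sup>2"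
      by (intro tendsto_intros p)
    moreover have "(\<lambda>n. d + 1 / Suc n) \<longlonglongrightarrow> d + 0"
      by (intro tendsto_intros LIMSEQ_Suc[OF lim_1_over_n])
    ultimately have "(norm (v - p))\<^sup>2 \<le> d"
      using f by (intro LIMSEQ_le[of _ _ _ "d"]) (auto intro: less_imp_le)
    then have "(norm (v - p))\<^sup>2 \<le> (norm (v - s))\<^sup>2" using d_le[OF that] by (rule order_trans)
    then show ?thesis by (rule power2_le_imp_le) simp
  qed
  ultimately show ?thesis by blast
qed

lemma orthogonal_projection_exists:
  fixes v :: "'a::chilbert_space"
  assumes S: "closed S" "complex_subspace S"
  shows "\<exists>p\<in>S. \<forall>s\<in>S. cinner s (v - p) = 0"
proof -
  obtain p where p: "p \<in> S" and min: "\<And>s. s \<in> S \<Longrightarrow> norm (v - p) \<le> norm (v - s)"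
    using closest_point_subspace_exists[OF S] by blast
  have "cinner s (v - p) = 0" if s: "s \<in> S" for s
  proof (rule ccontr)
    assume nz: "cinner s (v - p) \<noteq> 0"
    then have s0: "0 < (norm s)\<^sup>2" by auto
    define c where "c = cinner s (v - p)"
    \<comment> \<open>t s is the component of v - p along s; moving p by it would lower the squared
      distance by |c|^2 / |s|^2, against minimality.\<close>
    define t where "t = c / complex_of_real ((norm s)\<^sup>2)"
    have "p + t *\<^sub>C s \<in> S" using S(2) p s unfolding complex_subspace_def by blast
    then have "(norm (v - p))\<^sup>2 \<le> (norm (v - (p + t *\<^sub>C s)))\<^sup>2"
      using min by (simp add: power_mono)
    also have "v - (p + t *\<^sub>C s) = (v - p) - t *\<^sub>C s" by simp
    also have "(norm \<dots>)\<^sup>2 = (norm (v - p))\<^sup>2 - 2 * Re (t * cnj c) + (cmod t)\<^sup>2 * (norm s)\<^sup>2"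
      using cinner_commute[of "v - p" s]
      by (simp add: norm_diff_sq cinner_scaleC_right c_def norm_scaleC power_mult_distrib)
    also have "t * cnj c = complex_of_real ((cmod c)\<^sup>2 / (norm s)\<^sup>2)"
      unfolding t_def of_real_divide complex_norm_square by simp
    also have "(cmod t)\<^sup>2 * (norm s)\<^sup>2 = (cmod c)\<^sup>2 / (norm s)\<^sup>2"
    proof -
      have "cmod t = cmod c / (norm s)\<^sup>2" by (simp add: t_def norm_divide norm_power)
      then show ?thesis using s0 by (simp add: field_simps power2_eq_square)
    qed
    finally have "(cmod c)\<^sup>2 / (norm s)\<^sup>2 \<le> 0" by simp
    moreover have "0 < (cmod c)\<^sup>2 / (norm s)\<^sup>2" using nz s0 by (simp add: c_def)
    ultimately show False by simp
  qed
  then show ?thesis using p by blast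
qed

text \<open>The residue of t after projection onto S stays in T because S \<subseteq> T. Applied to
  graphs, with S the closure of a core, it shows that the core determines the operator.\<close>

lemma closed_subspace_eq_if_orthogonal_trivial:
  fixes S :: "'a::chilbert_space set"
  assumes "closed S" "complex_subspace S" "complex_subspace T" "S \<subseteq> T"
    and "\<And>t. t \<in> T \<Longrightarrow> (\<And>s. s \<in> S \<Longrightarrow> cinner s t = 0) \<Longrightarrow> t = 0"
  shows "S = T"
proof
  show "T \<subseteq> S"
  proof
    fix t assume t: "t \<in> T"
    obtain p where "p \<in> S" "\<forall>s\<in>S. cinner s (t - p) = 0"
      using orthogonal_projection_exists assms(1,2) by blast
    moreover from this have "t - p \<in> T"
      using t assms(3,4) complex_subspace_diff by blast
    ultimately have "t - p = 0" using assms(5) by blast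
    then show "t \<in> S" using \<open>p \<in> S\<close> by simp
  qed
qed fact

lemma riesz_representation:
  fixes \<phi> :: "'a::chilbert_space \<Rightarrow> complex"
  assumes bl: "bounded_linear \<phi>" and \<phi>: "\<And>c v. \<phi> (c *\<^sub>C v) = c * \<phi> v"
  shows "\<exists>z. \<forall>v. \<phi> v = cinner z v"
proof (cases "\<forall>v. \<phi> v = 0")
  case True then show ?thesis by (intro exI[of _ 0]) simp
next
  case False
  then obtain v where v: "\<phi> v \<noteq> 0" by blast
  interpret bounded_linear \<phi> by fact
  let ?K = "{v. \<phi> v = 0}"
  have "closed ?K"
    by (intro closed_Collect_eq continuous_intros) (simp add: linear_continuous_on bl)
  moreover have "complex_subspace ?K"
    unfolding complex_subspace_def by (simp add: add zero \<phi>)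
  ultimately obtain p where p: "\<phi> p = 0" and orth: "\<And>s. \<phi> s = 0 \<Longrightarrow> cinner s (v - p) = 0"
    using orthogonal_projection_exists[of ?K v] by blast
  define z where "z = v - p"
  have z: "\<phi> z \<noteq> 0" using v p by (simp add: z_def diff)
  then have z0: "z \<noteq> 0" using zero by auto
  have "\<phi> x = cinner ((cnj (\<phi> z) / complex_of_real ((norm z)\<^sup>2)) *\<^sub>C z) x" for x
  proof -
    have "cinner (x - (\<phi> x / \<phi> z) *\<^sub>C z) z = 0"
      unfolding z_def[symmetric] using orth[folded z_def] z by (simp add: diff \<phi>)
    then have "cinner z (x - (\<phi> x / \<phi> z) *\<^sub>C z) = 0"
      by (metis cinner_commute complex_cnj_zero)
    then have "cinner z x = \<phi> x / \<phi> z * complex_of_real ((norm z)\<^sup>2)"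
      by (simp add: cinner_diff_right cinner_scaleC_right cinner_self)
    then show ?thesis using z z0 by (simp add: cinner_scaleC_left)
  qed
  then show ?thesis by blast
qed

section \<open>Adjoints of bounded operators\<close>

lemma bounded_ops_apply: "u \<in> bounded_ops \<Longrightarrow> blinfun_apply u (c *\<^sub>C v) = c *\<^sub>C u v"
  by (simp add: bounded_ops_def)

lemma is_adjointD: "is_adjoint u w \<Longrightarrow> cinner (blinfun_apply u x) y = cinner x (blinfun_apply w y)"
  by (simp add: is_adjoint_def)

lemma is_adjoint_commute: "is_adjoint u w \<Longrightarrow> is_adjoint w u"
  unfolding is_adjoint_def by (metis cinner_commute)

lemma cinner_ext: "(\<And>x. cinner x y = cinner x z) \<Longrightarrow> y = (z :: 'a::chilbert_space)"
  using cinner_self_eq_0_iff[of "y - z"] by (simp add: cinner_diff_right)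

text \<open>Riesz representation of v \<mapsto> <y, u v>. Within M adjoints are part of the
  definition; this supplies them for the commutant.\<close>

lemma adjoint_exists:
  fixes u :: "'a::chilbert_space \<Rightarrow>\<^sub>L 'a"
  assumes u: "u \<in> bounded_ops"
  shows "\<exists>w\<in>bounded_ops. is_adjoint u w"
proof -
  have "\<exists>z. \<forall>v. cinner y (u v) = cinner z v" for y
    by (rule riesz_representation)
      (auto simp: cinner_scaleC_right bounded_ops_apply[OF u]
        intro!: bounded_linear_compose[OF bounded_bilinear.bounded_linear_right[OF
          bounded_bilinear_cinner]] blinfun.bounded_linear_right)
  then obtain w where w: "\<And>y v. cinner y (u v) = cinner (w y) v" by metis
  have w': "cinner (u x) y = cinner x (w y)" for x y
    by (metis w cinner_commute)
  have add: "w (x + y) = w x + w y" for x y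
    by (rule cinner_ext) (simp add: cinner_add_right flip: w')
  have scC: "w (c *\<^sub>C x) = c *\<^sub>C w x" for c x
    by (rule cinner_ext) (simp add: cinner_scaleC_right flip: w')
  have "norm (w y) \<le> norm y * norm u" for y
  proof (cases "w y = 0")
    case False
    have "(norm (w y))\<^sup>2 = cmod (cinner (w y) (w y))"
      by (simp only: cinner_self norm_of_real) simp
    also have "\<dots> = cmod (cinner y (u (w y)))" by (simp only: w)
    also have "\<dots> \<le> norm y * norm (u (w y))" by (rule cauchy_schwarz)
    also have "\<dots> \<le> norm y * (norm u * norm (w y))"
      by (intro mult_left_mono norm_blinfun) simp
    finally show ?thesis using False by (simp add: power2_eq_square)
  qed simp
  then have bl: "bounded_linear w"
    by (intro bounded_linear_intro[where K = "norm u"])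
      (simp_all add: add scC flip: scaleC_of_real)
  show ?thesis
    by (rule bexI[of _ "Blinfun w"])
      (simp_all add: is_adjoint_def bounded_ops_def bounded_linear_Blinfun_apply[OF bl] w' scC)
qed

text \<open>Graphs become subspaces of a Hilbert space, so that orthogonal projection applies to
  them.\<close>

instantiation prod :: (chilbert_space, chilbert_space) chilbert_space
begin

definition scaleC_prod_def: "c *\<^sub>C x = (c *\<^sub>C fst x, c *\<^sub>C snd x)"

definition cinner_prod_def: "cinner x y = cinner (fst x) (fst y) + cinner (snd x) (snd y)"

instance
proof
  fix x y :: "'a \<times> 'b"
  show "cinner x y = cnj (cinner y x)"
    by (simp add: cinner_prod_def flip: cinner_commute)
  show "cinner x x = complex_of_real ((norm x)\<^sup>2)"
    by (simp add: cinner_prod_def norm_prod_def cinner_self)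
qed (simp_all add: scaleC_prod_def cinner_prod_def scaleC_add_right scaleC_add_left scaleC_scaleC
    scaleC_of_real cinner_simps algebra_simps prod_eq_iff)

end

lemma scaleC_Pair [simp]: "c *\<^sub>C (a, b) = (c *\<^sub>C a, c *\<^sub>C b)"
  by (simp add: scaleC_prod_def)

lemma cinner_Pair [simp]: "cinner (a, b) (c, d) = cinner a c + cinner b d"
  by (simp add: cinner_prod_def)

section \<open>Commutative von Neumann algebras\<close>

lemma scaleC_blinfun_apply [simp]: "blinfun_apply (scaleC_blinfun c u) v = c *\<^sub>C u v"
  by (simp add: scaleC_blinfun.rep_eq)

lemma commutantI:
  fixes u :: "'a::chilbert_space \<Rightarrow>\<^sub>L 'a"
  assumes "\<And>c v. blinfun_apply u (c *\<^sub>C v) = c *\<^sub>C u v"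
    and "\<And>s v. s \<in> S \<Longrightarrow> blinfun_apply u (blinfun_apply s v) = s (u v)"
  shows "u \<in> commutant S"
  using assms by (auto simp: commutant_def bounded_ops_def intro!: blinfun_eqI)

lemma commutant_scale: "u \<in> commutant S \<Longrightarrow> blinfun_apply u (c *\<^sub>C v) = c *\<^sub>C u v"
  by (simp add: commutant_def bounded_ops_def)

lemma commutant_commute: "u \<in> commutant S \<Longrightarrow> s \<in> S \<Longrightarrow> blinfun_apply u (blinfun_apply s v) = s (u v)"
  unfolding commutant_def by (metis (mono_tags, lifting) blinfun_apply_blinfun_compose mem_Collect_eq)

text \<open>Norm limits thereby stay in M, both for the square root iteration and for the gliding
  hump series.\<close>

lemma closed_commutant: "closed (commutant S)"
proof -
  have "commutant S = (\<Inter>c. \<Inter>v. {u. blinfun_apply u (c *\<^sub>C v) = c *\<^sub>C u v})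
      \<inter> (\<Inter>s\<in>S. {u. u o\<^sub>L s = s o\<^sub>L u})"
    unfolding commutant_def bounded_ops_def by auto
  moreover have "closed {u. blinfun_apply u (c *\<^sub>C v) = c *\<^sub>C u v}" for c and v :: 'a
    by (intro closed_Collect_eq continuous_intros)
  moreover have "closed {u. u o\<^sub>L s = s o\<^sub>L u}" for s :: "'a \<Rightarrow>\<^sub>L 'a"
    by (intro closed_Collect_eq continuous_intros
        bounded_bilinear.continuous_on[OF bounded_bilinear_blinfun_compose])
  ultimately show ?thesis by (auto intro!: closed_Int closed_INT)
qed

locale commutative_von_neumann_algebra =
  fixes M :: "('a::chilbert_space \<Rightarrow>\<^sub>L 'a) set"
  assumes vna: "von_neumann_algebra M" and commutative: "commutative_ops M"
begin

lemma M_eq: "commutant (commutant M) = M"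
  using vna by (simp add: von_neumann_algebra_def)

lemma M_bounded_ops: "u \<in> M \<Longrightarrow> u \<in> bounded_ops"
  using M_eq by (auto simp: commutant_def)

lemma M_scale: "u \<in> M \<Longrightarrow> blinfun_apply u (c *\<^sub>C v) = c *\<^sub>C u v"
  by (simp add: M_bounded_ops bounded_ops_apply)

lemma M_commute: "u \<in> M \<Longrightarrow> w \<in> M \<Longrightarrow> blinfun_apply u (blinfun_apply w v) = w (u v)"
  using commutative unfolding commutative_ops_def by (metis blinfun_apply_blinfun_compose)

lemma M_compose_commute: "u \<in> M \<Longrightarrow> w \<in> M \<Longrightarrow> u o\<^sub>L w = w o\<^sub>L u"
  using commutative unfolding commutative_ops_def by blast

lemma M_closed: "closed M"
  using closed_commutant[of "commutant M"] M_eq by simp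

text \<open>Bicommutant: membership in M is tested against the commutant, and all closure properties
  of M follow by computation on vectors.\<close>

lemma MI:
  assumes "\<And>c v. blinfun_apply u (c *\<^sub>C v) = c *\<^sub>C u v"
    and "\<And>s v. s \<in> commutant M \<Longrightarrow> blinfun_apply u (blinfun_apply s v) = s (u v)"
  shows "u \<in> M"
  using commutantI[of u "commutant M", OF assms] M_eq by simp

lemma M_commutant_commute:
  "u \<in> M \<Longrightarrow> s \<in> commutant M \<Longrightarrow> blinfun_apply u (blinfun_apply s v) = s (u v)"
  by (simp add: commutant_commute[of s M u v])

lemma M_id [simp, intro]: "id_blinfun \<in> M"
  by (rule MI) simp_all

lemma M_zero [simp, intro]: "0 \<in> M"
  by (rule MI) (simp_all add: commutant_scale)

lemma M_add [simp, intro]: "u \<in> M \<Longrightarrow> w \<in> M \<Longrightarrow> u + w \<in> M"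
  by (rule MI)
    (simp_all add: blinfun.bilinear_simps M_scale M_commutant_commute scaleC_add_right)

lemma M_compose [simp, intro]: "u \<in> M \<Longrightarrow> w \<in> M \<Longrightarrow> u o\<^sub>L w \<in> M"
  by (rule MI) (simp_all add: M_scale M_commutant_commute)

lemma M_scaleC [simp, intro]: "u \<in> M \<Longrightarrow> scaleC_blinfun c u \<in> M"
  by (rule MI) (simp_all add: M_scale M_commutant_commute scaleC_scaleC mult.commute
      commutant_scale)

lemma M_scaleR [simp, intro]: "u \<in> M \<Longrightarrow> r *\<^sub>R u \<in> M"
  using M_scaleC[of u "of_real r"]
  by (metis (no_types, lifting) blinfun_eqI blinfun.scaleR_left scaleC_blinfun_apply scaleC_of_real)

lemma M_uminus [simp, intro]: "u \<in> M \<Longrightarrow> - u \<in> M"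
  using M_scaleR[of u "-1"] by simp

lemma M_diff [simp, intro]: "u \<in> M \<Longrightarrow> w \<in> M \<Longrightarrow> u - w \<in> M"
  using M_add[of u "- w"] by simp

lemma M_adjoint: "u \<in> M \<Longrightarrow> \<exists>w\<in>M. is_adjoint u w"
  using vna by (simp add: von_neumann_algebra_def)

text \<open>Take adjoints in y t = t y, where t is the adjoint of s. It serves to move elements of
  the commutant across the inner product when projecting onto a graph that they leave
  invariant.\<close>

lemma commutant_adjoint:
  assumes "y \<in> commutant M"
  shows "\<exists>z\<in>commutant M. is_adjoint y z"
proof -
  obtain z where z: "z \<in> bounded_ops" and adj: "is_adjoint y z"
    using adjoint_exists assms by (auto simp: commutant_def)
  have "blinfun_apply z (blinfun_apply s v) = s (z v)" if s: "s \<in> M" for s v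
  proof (rule cinner_ext)
    fix x
    obtain t where t: "t \<in> M" "is_adjoint t s"
      using M_adjoint[OF s] is_adjoint_commute by blast
    show "cinner x (z (s v)) = cinner x (s (z v))"
      using commutant_commute[OF assms t(1), of x]
      by (simp flip: is_adjointD[OF adj] is_adjointD[OF t(2)])
  qed
  then have "z \<in> commutant M" using z by (auto intro!: commutantI simp: bounded_ops_apply)
  then show ?thesis using adj by blast
qed

text \<open>By commutativity a s a = s a a = 0 for the adjoint s of a; two norm computations then
  give s a = 0 and a = 0. This is what allows squares to be cancelled later on.\<close>

lemma M_reduced:
  assumes a: "a \<in> M" and aa: "a o\<^sub>L a = 0"
  shows "a = 0"
proof (rule blinfun_eqI)
  fix v
  obtain s where s: "s \<in> M" "is_adjoint a s" using M_adjoint a by blast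
  have "a (s (a v)) = 0"
    using M_commute[OF a s(1), of "a v"] aa blinfun_apply_blinfun_compose[of a a v]
      blinfun.zero_left blinfun.zero_right by metis
  then have "cinner (s (a v)) (s (a v)) = 0"
    using is_adjointD[OF s(2), of "s (a v)" "a v"] by simp
  then have "s (a v) = 0" by (simp add: cinner_self_eq_0_iff)
  then have "cinner (a v) (a v) = 0" using is_adjointD[OF s(2), of v "a v"] by simp
  then show "blinfun_apply a v = blinfun_apply 0 v" by (simp add: cinner_self_eq_0_iff)
qed

end

section \<open>Affiliated operators as fractions\<close>

text \<open>The operator \<open>b\<inverse>c\<close>; for commuting \<open>b\<close>, \<open>c\<close> it extends \<open>c b\<inverse>\<close>, whose graph is
  the range of \<open>u \<mapsto> (b u, c u)\<close>.\<close>

definition frac :: "('a::chilbert_space \<Rightarrow>\<^sub>L 'a) \<Rightarrow> ('a \<Rightarrow>\<^sub>L 'a) \<Rightarrow> 'a operator" where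
  "frac b c = {(v, w). blinfun_apply b w = c v}"

lemma closed_frac: "closed (frac b c)"
  unfolding frac_def case_prod_unfold
  by (intro closed_Collect_eq continuous_intros)

context commutative_von_neumann_algebra
begin

text \<open>Injectivity without a lower bound: the inverse of b may be unbounded, as it must be to
  represent unbounded operators.\<close>

definition denominators :: "('a \<Rightarrow>\<^sub>L 'a) set" where
  "denominators = {b \<in> M. \<forall>v. blinfun_apply b v = 0 \<longrightarrow> v = 0}"

lemma denominators_M: "b \<in> denominators \<Longrightarrow> b \<in> M"
  by (simp add: denominators_def)

lemma denominators_cancel: "b \<in> denominators \<Longrightarrow> blinfun_apply b v = blinfun_apply b w \<longleftrightarrow> v = w"
  unfolding denominators_def
  by (metis (mono_tags, lifting) blinfun.diff_right mem_Collect_eq right_minus_eq)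

lemma denominators_cancel_0: "b \<in> denominators \<Longrightarrow> blinfun_apply b v = 0 \<longleftrightarrow> v = 0"
  using denominators_cancel[of b v 0] by simp

lemma denominators_id: "id_blinfun \<in> denominators"
  by (simp add: denominators_def)

lemma denominators_compose:
  assumes "b \<in> denominators" "d \<in> denominators"
  shows "b o\<^sub>L d \<in> denominators"
proof -
  have "b o\<^sub>L d \<in> M" using assms by (simp add: denominators_M M_compose)
  moreover have "v = 0" if "blinfun_apply b (blinfun_apply d v) = 0" for v
    using that assms by (simp only: denominators_cancel_0)
  ultimately show ?thesis by (simp add: denominators_def)
qed

lemma complex_subspace_frac: "b \<in> M \<Longrightarrow> c \<in> M \<Longrightarrow> complex_subspace (frac b c)"
  unfolding complex_subspace_def frac_def by (auto simp: blinfun.bilinear_simps M_scale zero_prod_def)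

lemma complex_subspace_core:
  "b \<in> M \<Longrightarrow> c \<in> M \<Longrightarrow> complex_subspace (range (\<lambda>u. (blinfun_apply b u, blinfun_apply c u)))"
  unfolding complex_subspace_def
proof (intro conjI ballI allI)
  let ?g = "\<lambda>u. (blinfun_apply b u, blinfun_apply c u)"
  show "0 \<in> range ?g" by (rule range_eqI[of _ _ 0]) (simp add: zero_prod_def)
  show "x + y \<in> range ?g" if "x \<in> range ?g" "y \<in> range ?g" for x y
  proof -
    from that obtain u v where "x = ?g u" "y = ?g v" by blast
    then show ?thesis by (intro range_eqI[of _ _ "u + v"]) (simp add: blinfun.add_right)
  qed
  show "k *\<^sub>C x \<in> range ?g" if "b \<in> M" "c \<in> M" "x \<in> range ?g" for k x
  proof -
    from that obtain u where "x = ?g u" by blast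
    then show ?thesis using that by (intro range_eqI[of _ _ "k *\<^sub>C u"]) (simp add: M_scale)
  qed
qed

text \<open>If (v, w) lies in the fraction and is orthogonal to the core, then b'v + c'w = 0.
  Applying b and using b w = c v gives (b'b + c'c) v = 0, hence b v = 0 and v = w = 0.\<close>

lemma closure_core:
  assumes b: "b \<in> denominators" and c: "c \<in> M"
  shows "closure (range (\<lambda>u. (blinfun_apply b u, blinfun_apply c u))) = frac b c"
    (is "closure ?R = _")
proof (rule closed_subspace_eq_if_orthogonal_trivial)
  note bM = denominators_M[OF b]
  show "closure ?R \<subseteq> frac b c"
    by (rule closure_minimal[OF _ closed_frac]) (auto simp: frac_def M_commute[OF bM c])
  show "complex_subspace (closure ?R)"
    by (intro complex_subspace_closure complex_subspace_core bM c)
  fix t assume t: "t \<in> frac b c" and orth: "\<And>s. s \<in> closure ?R \<Longrightarrow> cinner s t = 0"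
  obtain v w where tvw: "t = (v, w)" by fastforce
  have bw: "b w = c v" using t by (simp add: frac_def tvw)
  obtain b' c' where b': "b' \<in> M" "is_adjoint b b'" and c': "c' \<in> M" "is_adjoint c c'"
    using M_adjoint bM c by meson
  have "cinner u (b' v + c' w) = 0" for u
    using orth[of "(b u, c u)"] closure_subset[of ?R]
    by (auto simp: tvw cinner_add_right is_adjointD[OF b'(2)] is_adjointD[OF c'(2)])
  then have "b' v + c' w = 0" by (metis cinner_ext cinner_zero_right)
  then have "b (b' v + c' w) = 0" by simp
  then have "b' (b v) + c' (c v) = 0"
    by (simp add: blinfun.add_right M_commute[OF bM] b'(1) c'(1) bw)
  then have "cinner v (b' (b v)) + cinner v (c' (c v)) = 0"
    by (simp flip: cinner_add_right)
  then have "complex_of_real ((norm (b v))\<^sup>2 + (norm (c v))\<^sup>2) = 0"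
    by (simp add: cinner_self flip: is_adjointD[OF b'(2)] is_adjointD[OF c'(2)])
  then have "(norm (b v))\<^sup>2 + (norm (c v))\<^sup>2 = 0" by (simp only: of_real_eq_0_iff)
  then have "b v = 0" by (simp add: add_nonneg_eq_0_iff)
  then have v: "v = 0" using b by (simp add: denominators_cancel_0)
  then have "w = 0" using bw b by (simp add: denominators_cancel_0)
  then show "t = 0" using v by (simp add: tvw zero_prod_def)
qed (simp_all add: complex_subspace_frac denominators_M b c)

text \<open>Whatever lies between the core and the fraction has the fraction as its closure. Strong
  sums, multiples and left products are identified by these two inclusions, without describing their
  exact domains.\<close>

lemma closure_eq_fracI:
  assumes "b \<in> denominators" "c \<in> M" "x \<subseteq> frac b c"
    and "\<And>u. (blinfun_apply b u, blinfun_apply c u) \<in> x"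
  shows "closure x = frac b c"
  using closure_core[OF assms(1,2)] closure_mono[of "range (\<lambda>u. (b u, c u))" x]
    closure_minimal[OF assms(3) closed_frac] assms(4) by auto

lemma core_in_frac: "b \<in> denominators \<Longrightarrow> c \<in> M \<Longrightarrow> (blinfun_apply b u, blinfun_apply c u) \<in> frac b c"
  by (simp add: frac_def M_commute denominators_M)

text \<open>Evaluate at the core points (b u, c u) and cancel b. This turns equations between
  operators into equations in M.\<close>

lemma frac_inject:
  assumes "b \<in> denominators" "c \<in> M" "d \<in> M"
  shows "frac b c = frac b d \<longleftrightarrow> c = d"
proof
  assume eq: "frac b c = frac b d"
  have "c u = d u" for u
    using core_in_frac[OF assms(1,2), of u] assms
    unfolding eq by (simp add: frac_def denominators_cancel M_commute[OF _ denominators_M])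
  then show "c = d" by (rule blinfun_eqI)
qed simp

lemma frac_expand:
  assumes "b \<in> denominators" "c \<in> M" "d \<in> denominators"
  shows "frac (d o\<^sub>L b) (d o\<^sub>L c) = frac b c"
  using assms by (simp add: frac_def denominators_cancel)

lemma of_bounded_0_eq_frac: "b \<in> denominators \<Longrightarrow> of_bounded 0 = frac b 0"
  by (auto simp: of_bounded_def frac_def denominators_cancel_0)

section \<open>Strong operations over a common denominator\<close>

lemma strong_add_frac:
  assumes "b \<in> denominators" "c \<in> M" "d \<in> M"
  shows "strong_add (frac b c) (frac b d) = frac b (c + d)"
  unfolding strong_add_def
proof (rule closure_eq_fracI)
  show "op_add (frac b c) (frac b d) \<subseteq> frac b (c + d)"
    by (auto simp: op_add_def frac_def blinfun.bilinear_simps)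
  show "(b u, (c + d) u) \<in> op_add (frac b c) (frac b d)" for u
    using core_in_frac[OF assms(1,2), of u] core_in_frac[OF assms(1,3), of u]
    unfolding op_add_def by (auto simp: blinfun.add_left)
qed (use assms in auto)

lemma strong_scale_frac:
  assumes "b \<in> denominators" "c \<in> M"
  shows "strong_scale k (frac b c) = frac b (scaleC_blinfun k c)"
  unfolding strong_scale_def
proof (rule closure_eq_fracI)
  show "op_scale k (frac b c) \<subseteq> frac b (scaleC_blinfun k c)"
    using assms by (auto simp: op_scale_def frac_def M_scale denominators_M)
  show "(b u, scaleC_blinfun k c u) \<in> op_scale k (frac b c)" for u
    using core_in_frac[OF assms(1,2), of u] unfolding op_scale_def by auto
qed (use assms in auto)

lemma strong_mult_left_frac:
  assumes "b \<in> denominators" "c \<in> M" "u \<in> M"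
  shows "strong_mult (of_bounded u) (frac b c) = frac b (u o\<^sub>L c)"
  unfolding strong_mult_def
proof (rule closure_eq_fracI)
  show "op_mult (of_bounded u) (frac b c) \<subseteq> frac b (u o\<^sub>L c)"
    using assms
    by (auto simp: op_mult_def of_bounded_def frac_def M_commute[OF denominators_M[of b] assms(3)])
  show "(b v, (u o\<^sub>L c) v) \<in> op_mult (of_bounded u) (frac b c)" for v
    using core_in_frac[OF assms(1,2), of v] unfolding op_mult_def of_bounded_def by auto
qed (use assms in auto)

text \<open>The composition is already closed here: b w = c (u v) is the defining equation of the
  fraction with numerator u c. Left and right products have the same numerator, so the bimodule
  action is symmetric.\<close>

lemma strong_mult_right_frac:
  assumes "b \<in> denominators" "c \<in> M" "u \<in> M"
  shows "strong_mult (frac b c) (of_bounded u) = frac b (u o\<^sub>L c)"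
proof -
  have "op_mult (frac b c) (of_bounded u) = frac b (u o\<^sub>L c)"
    using assms by (auto simp: op_mult_def of_bounded_def frac_def relcomp_unfold M_commute[of u c])
  then show ?thesis by (simp add: strong_mult_def closure_closed closed_frac)
qed

text \<open>The numerator and the denominator are read off the projection of \<open>(v, 0)\<close> onto the graph.\<close>

lemma affiliated_eq_frac:
  assumes lin: "linear_operator x" and cl: "closed x" and dense: "densely_defined x"
    and aff: "affiliated M x"
  shows "\<exists>b\<in>denominators. \<exists>c\<in>M. x = frac b c"
proof -
  have sub: "complex_subspace x"
    using lin unfolding linear_operator_def complex_subspace_def by (auto simp: zero_prod_def)
  have "\<exists>p q. (p, q) \<in> x \<and> (\<forall>a d. (a, d) \<in> x \<longrightarrow> cinner a p + cinner d q = cinner a v)" for v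
  proof -
    obtain p q where pq: "(p, q) \<in> x" and "\<forall>s\<in>x. cinner s ((v, 0) - (p, q)) = 0"
      using orthogonal_projection_exists[OF cl sub, of "(v, 0)"] by force
    then have "cinner a p + cinner d q = cinner a v" if "(a, d) \<in> x" for a d
      using that by (auto simp: cinner_diff_right cinner_minus_right algebra_simps)
    then show ?thesis using pq by blast
  qed
  \<comment> \<open>Classically B is the inverse of 1 + x* x, and C = x B.\<close>
  then obtain B C where BC: "\<And>v. (B v, C v) \<in> x"
    and orth: "\<And>v a d. (a, d) \<in> x \<Longrightarrow> cinner a (B v) + cinner d (C v) = cinner a v"
    by metis
  \<comment> \<open>Linearity of B and C and their commutation with the commutant are all read off
    this uniqueness.\<close>
  have uniq: "p = B v \<and> q = C v"
    if "(p, q) \<in> x" and "\<And>a d. (a, d) \<in> x \<Longrightarrow> cinner a p + cinner d q = cinner a v" for p q v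
  proof -
    have "(p - B v, q - C v) \<in> x"
      using complex_subspace_diff[OF sub that(1) BC[of v]] by simp
    from that(2)[OF this] orth[OF this, of v]
    have "cinner (p - B v) (p - B v) + cinner (q - C v) (q - C v) = 0"
      by (simp add: cinner_diff_right algebra_simps)
    then have "complex_of_real ((norm (p - B v))\<^sup>2 + (norm (q - C v))\<^sup>2) = 0"
      by (simp only: cinner_self of_real_add)
    then have "(norm (p - B v))\<^sup>2 + (norm (q - C v))\<^sup>2 = 0"
      by (simp only: of_real_eq_0_iff)
    then show ?thesis by (simp add: add_nonneg_eq_0_iff)
  qed
  have add: "B (u + v) = B u + B v \<and> C (u + v) = C u + C v" for u v
  proof -
    have "(B u + B v, C u + C v) \<in> x"
      using sub BC[of u] BC[of v] unfolding complex_subspace_def by (metis add_Pair)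
    moreover have "cinner a (B u + B v) + cinner d (C u + C v) = cinner a (u + v)"
      if "(a, d) \<in> x" for a d
      using orth[OF that, of u] orth[OF that, of v] by (simp add: cinner_add_right algebra_simps)
    ultimately show ?thesis using uniq[of "B u + B v" "C u + C v" "u + v"] by simp
  qed
  have scale: "B (k *\<^sub>C v) = k *\<^sub>C B v \<and> C (k *\<^sub>C v) = k *\<^sub>C C v" for k v
  proof -
    have "(k *\<^sub>C B v, k *\<^sub>C C v) \<in> x"
      using sub BC[of v] unfolding complex_subspace_def by (metis scaleC_Pair)
    moreover have "cinner a (k *\<^sub>C B v) + cinner d (k *\<^sub>C C v) = cinner a (k *\<^sub>C v)"
      if "(a, d) \<in> x" for a d
      using orth[OF that, of v] by (simp add: cinner_scaleC_right flip: distrib_left)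
    ultimately show ?thesis using uniq[of "k *\<^sub>C B v" "k *\<^sub>C C v" "k *\<^sub>C v"] by simp
  qed
  \<comment> \<open>The orthogonality relation tested at (B v, C v) itself; it makes both maps
    contractions.\<close>
  have sum: "(norm (B v))\<^sup>2 + (norm (C v))\<^sup>2 \<le> norm (B v) * norm v" for v
  proof -
    have "complex_of_real ((norm (B v))\<^sup>2 + (norm (C v))\<^sup>2) = cinner (B v) v"
      using orth[OF BC, of v v] by (simp only: cinner_self of_real_add)
    then have "(norm (B v))\<^sup>2 + (norm (C v))\<^sup>2 = Re (cinner (B v) v)"
      by (metis Re_complex_of_real)
    then show ?thesis using Re_cinner_le[of "B v" v] by simp
  qed
  have nB: "norm (B v) \<le> norm v" for v
  proof (cases "B v = 0")
    case False
    have "norm (B v) * norm (B v) \<le> norm (B v) * norm v"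
      using sum[of v] by (simp add: power2_eq_square)
        (smt (verit) zero_le_square)
    then show ?thesis using False by simp
  qed simp
  have nC: "norm (C v) \<le> norm v" for v
  proof -
    have "(norm (C v))\<^sup>2 \<le> norm (B v) * norm v" using sum[of v] by (smt (verit) zero_le_power2)
    also have "\<dots> \<le> (norm v)\<^sup>2" by (simp add: power2_eq_square mult_right_mono nB)
    finally show ?thesis by (rule power2_le_imp_le) simp
  qed
  have "bounded_linear B" "bounded_linear C"
    by (rule bounded_linear_intro[of _ 1]; simp add: add nB nC scale flip: scaleC_of_real)+
  note ap = this[THEN bounded_linear_Blinfun_apply]
  have commute: "B (s v) = s (B v) \<and> C (s v) = s (C v)" if s: "s \<in> commutant M"
    for s :: "'a \<Rightarrow>\<^sub>L 'a" and v
  proof -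
    \<comment> \<open>Affiliation says that the graph is invariant under y acting on both
      coordinates.\<close>
    have inv: "(blinfun_apply y a, blinfun_apply y d) \<in> x"
      if "(a, d) \<in> x" "y \<in> commutant M" for y a d
      using aff that unfolding affiliated_def op_mult_def of_bounded_def by blast
    obtain y where y: "y \<in> commutant M" "is_adjoint s y"
      using commutant_adjoint[OF s] by blast
    have "cinner a (s (B v)) + cinner d (s (C v)) = cinner a (s v)" if "(a, d) \<in> x" for a d
      using orth[OF inv[OF that y(1)], of v]
      by (simp add: is_adjointD[OF is_adjoint_commute[OF y(2)]])
    then show ?thesis using uniq[OF inv[OF BC s]] by metis
  qed
  define b c where "b = Blinfun B" and "c = Blinfun C"
  have "b \<in> M" "c \<in> M"
    by (rule MI; simp add: b_def c_def ap commute scale)+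
  \<comment> \<open>B v = 0 forces C v = 0 because x is single valued; then v is orthogonal to the
    domain of x, which is dense.\<close>
  moreover have "v = 0" if "B v = 0" for v
  proof -
    have "C v = 0"
      using BC[of v] lin that unfolding linear_operator_def single_valued_def by metis
    then have "cinner a v = 0" if "a \<in> Domain x" for a
    proof -
      from that obtain d where "(a, d) \<in> x" by blast
      from orth[OF this, of v] show ?thesis using \<open>B v = 0\<close> \<open>C v = 0\<close> by simp
    qed
    then have "Domain x \<subseteq> {a. cinner a v = 0}" by blast
    moreover have "closed {a. cinner a v = 0}"
      by (intro closed_Collect_eq continuous_intros)
    ultimately have "closure (Domain x) \<subseteq> {a. cinner a v = 0}" by (rule closure_minimal)
    then have "cinner v v = 0" using dense by (auto simp: densely_defined_def)
    then show ?thesis by (simp add: cinner_self_eq_0_iff)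
  qed
  ultimately have b: "b \<in> denominators" and c: "c \<in> M"
    by (auto simp: denominators_def b_def ap)
  let ?R = "range (\<lambda>u. (blinfun_apply b u, blinfun_apply c u))"
  have R: "?R \<subseteq> x" using BC by (auto simp: b_def c_def ap)
  have "closure ?R = x"
  proof (rule closed_subspace_eq_if_orthogonal_trivial)
    show "closure ?R \<subseteq> x" using R cl by (rule closure_minimal)
    show "complex_subspace (closure ?R)"
      by (intro complex_subspace_closure complex_subspace_core denominators_M b c)
    fix t assume t: "t \<in> x" and o: "\<And>s. s \<in> closure ?R \<Longrightarrow> cinner s t = 0"
    obtain a d where ad: "t = (a, d)" by fastforce
    \<comment> \<open>By the relation defining (B u, C u), tested at t = (a, d), the inner product
      of t with this core point is that of a with u.\<close>
    have "cinner u a = 0" for u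
    proof -
      have "(B u, C u) \<in> closure ?R" using closure_subset[of ?R] by (auto simp: b_def c_def ap)
      then have "cinner (B u) a + cinner (C u) d = 0" using o ad by fastforce
      then have "cinner a (B u) + cinner d (C u) = 0"
        by (metis cinner_commute complex_cnj_add complex_cnj_zero)
      then have "cinner a u = 0" using orth[of a d u] t ad by simp
      then show ?thesis by (metis cinner_commute complex_cnj_zero)
    qed
    then have "a = 0" by (metis cinner_self_eq_0_iff)
    moreover from this have "d = 0"
      using t lin ad unfolding linear_operator_def single_valued_def by metis
    ultimately show "t = 0" using ad by (simp add: zero_prod_def)
  qed (use cl sub in auto)
  then show ?thesis using closure_core[OF b c] b c by auto
qed

section \<open>Square roots, unitaries and scalars\<close>

lemma is_adjoint_scaleR_self: "is_adjoint u u \<Longrightarrow> is_adjoint (r *\<^sub>R u) (r *\<^sub>R u)"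
  by (simp add: is_adjoint_def blinfun.scaleR_left cinner_scaleR_left cinner_scaleR_right)

lemma is_adjoint_diff_self: "is_adjoint u u \<Longrightarrow> is_adjoint w w \<Longrightarrow> is_adjoint (u - w) (u - w)"
  by (simp add: is_adjoint_def blinfun.diff_left cinner_simps)

lemma is_adjoint_add_self: "is_adjoint u u \<Longrightarrow> is_adjoint w w \<Longrightarrow> is_adjoint (u + w) (u + w)"
  by (simp add: is_adjoint_def blinfun.add_left cinner_simps)

lemma is_adjoint_square_self: "is_adjoint u u \<Longrightarrow> is_adjoint (u o\<^sub>L u) (u o\<^sub>L u)"
  by (simp add: is_adjoint_def)

lemma is_adjoint_id: "is_adjoint id_blinfun id_blinfun"
  by (simp add: is_adjoint_def)

text \<open>\<open>S = (T + S\<^sup>2) / 2\<close> is solved by iteration; the same iteration with \<open>1\<close> in place of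
  \<open>T\<close> is a bounded monotone real sequence that majorizes the increments.\<close>

lemma sqrt_exists:
  assumes T: "T \<in> M" "is_adjoint T T" and nT: "norm T \<le> 1"
  shows "\<exists>S\<in>M. is_adjoint S S \<and> norm S \<le> 1 \<and> (id_blinfun - S) o\<^sub>L (id_blinfun - S) = id_blinfun - T"
proof -
  \<comment> \<open>The limit is 1 - sqrt(1 - T): (1 - S)^2 = 1 - T is the fixed point
    equation.\<close>
  define S where "S = rec_nat (0 :: 'a \<Rightarrow>\<^sub>L 'a) (\<lambda>_ s. (1/2) *\<^sub>R (T + (s o\<^sub>L s)))"
  define r where "r = rec_nat (0 :: real) (\<lambda>_ s. (1 + s * s) / 2)"
  have S0: "S 0 = 0" and SS: "\<And>n. S (Suc n) = (1/2) *\<^sub>R (T + (S n o\<^sub>L S n))"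
    by (simp_all add: S_def)
  have r0: "r 0 = 0" and rS: "\<And>n. r (Suc n) = (1 + r n * r n) / 2"
    by (simp_all add: r_def)
  have SM: "S n \<in> M" for n
    by (induction n) (simp_all add: S0 SS T M_scaleR)
  have Sadj: "is_adjoint (S n) (S n)" for n
    by (induction n) (simp add: S0 is_adjoint_def, simp add: SS is_adjoint_scaleR_self
        is_adjoint_add_self is_adjoint_square_self T)
  have rb: "0 \<le> r n \<and> r n \<le> 1" for n
  proof (induction n)
    case (Suc n)
    then have "r n * r n \<le> 1" by (simp add: mult_le_one)
    then show ?case by (simp add: rS)
  qed (simp add: r0)
  have nS: "norm (S n) \<le> r n" for n
  proof (induction n)
    case (Suc n)
    have "norm (S n o\<^sub>L S n) \<le> r n * r n"
      using norm_blinfun_compose[of "S n" "S n"] mult_mono[OF Suc Suc] rb[of n] by simp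
    then have "norm (T + (S n o\<^sub>L S n)) \<le> 1 + r n * r n"
      using norm_triangle_ineq[of T "S n o\<^sub>L S n"] nT by simp
    then show ?case by (simp add: SS rS)
  qed (simp add: S0 r0)
  have step: "norm (S (Suc n) - S n) \<le> r (Suc n) - r n" for n
  proof (induction n)
    case 0
    show ?case using nT by (simp add: S0 SS r0 rS blinfun_compose_zero)
  next
    case (Suc n)
    have "S (Suc (Suc n)) - S (Suc n) = (1/2) *\<^sub>R ((S (Suc n) o\<^sub>L S (Suc n)) - (S n o\<^sub>L S n))"
      unfolding SS[of "Suc n"] SS[of n] by (simp add: algebra_simps)
    \<comment> \<open>The factorization of a difference of squares uses that the iterates
      commute.\<close>
    also have "(S (Suc n) o\<^sub>L S (Suc n)) - (S n o\<^sub>L S n) = (S (Suc n) - S n) o\<^sub>L (S (Suc n) + S n)"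
      by (rule blinfun_eqI) (simp add: blinfun.bilinear_simps M_commute[OF SM[of n] SM[of "Suc n"]])
    finally have eq: "S (Suc (Suc n)) - S (Suc n)
        = (1/2) *\<^sub>R ((S (Suc n) - S n) o\<^sub>L (S (Suc n) + S n))" .
    have "norm ((S (Suc n) - S n) o\<^sub>L (S (Suc n) + S n))
        \<le> norm (S (Suc n) - S n) * norm (S (Suc n) + S n)"
      by (rule norm_blinfun_compose)
    also have "\<dots> \<le> (r (Suc n) - r n) * (r (Suc n) + r n)"
      using norm_triangle_ineq[of "S (Suc n)" "S n"] nS[of n] nS[of "Suc n"] Suc
        order_trans[OF norm_ge_zero Suc]
      by (intro mult_mono) simp_all
    also have "\<dots> = 2 * (r (Suc (Suc n)) - r (Suc n))"
      unfolding rS[of "Suc n"] by (simp add: rS[of n] field_simps)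
    finally show ?case by (simp add: eq)
  qed
  have far: "norm (S (n + k) - S n) \<le> r (n + k) - r n" for n k
  proof (induction k)
    case (Suc k)
    have "S (n + Suc k) - S n = (S (Suc (n + k)) - S (n + k)) + (S (n + k) - S n)" by simp
    then show ?case
      using norm_triangle_ineq[of "S (Suc (n + k)) - S (n + k)" "S (n + k) - S n"]
        step[of "n + k"] Suc by simp
  qed simp
  have "incseq r"
    using step by (intro incseq_SucI) (smt (verit) norm_ge_zero)
  then have "convergent r"
    using rb by (intro Bseq_monoseq_convergent) (auto intro!: BseqI'[of _ 1] simp: monoseq_iff)
  then have "Cauchy r" by (rule convergent_Cauchy)
  have "Cauchy S"
  proof (rule CauchyI)
    fix e :: real assume "0 < e"
    then obtain K where K: "\<And>m n. m \<ge> K \<Longrightarrow> n \<ge> K \<Longrightarrow> norm (r m - r n) < e"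
      using CauchyD[OF \<open>Cauchy r\<close>] by meson
    have "norm (S m - S n) < e" if "m \<ge> K" "n \<ge> K" "n \<le> m" for m n
      using far[of n "m - n"] K[OF that(1,2)] that(3) by simp
    then have "norm (S m - S n) < e" if "m \<ge> K" "n \<ge> K" for m n
      using that by (metis nat_le_linear norm_minus_commute)
    then show "\<exists>K. \<forall>m\<ge>K. \<forall>n\<ge>K. norm (S m - S n) < e" by blast
  qed
  then obtain L where L: "S \<longlonglongrightarrow> L" using Cauchy_convergent convergent_def by blast
  have LM: "L \<in> M" using M_closed SM L closed_sequentially by blast
  have "is_adjoint L L"
    unfolding is_adjoint_def
  proof (intro allI)
    fix u v
    have "(\<lambda>n. cinner (S n u) v) \<longlonglongrightarrow> cinner (L u) v"
      by (intro tendsto_intros L)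
    moreover have "(\<lambda>n. cinner (S n u) v) \<longlonglongrightarrow> cinner u (L v)"
      unfolding is_adjointD[OF Sadj] by (intro tendsto_intros L)
    ultimately show "cinner (L u) v = cinner u (L v)" by (rule LIMSEQ_unique)
  qed
  moreover have "norm L \<le> 1"
    using nS rb by (intro LIMSEQ_le_const2[OF tendsto_norm[OF L]]) (meson order_trans)
  moreover have "(\<lambda>n. S (Suc n)) \<longlonglongrightarrow> (1/2) *\<^sub>R (T + (L o\<^sub>L L))"
    unfolding SS
    by (intro tendsto_intros L bounded_bilinear.tendsto[OF bounded_bilinear_blinfun_compose])
  then have eqL: "L = (1/2) *\<^sub>R (T + (L o\<^sub>L L))"
    using LIMSEQ_Suc[OF L] LIMSEQ_unique by blast
  have "(id_blinfun - L) o\<^sub>L (id_blinfun - L) = id_blinfun - T"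
  proof (rule blinfun_eqI)
    fix v
    have "2 *\<^sub>R L v = T v + L (L v)"
      using arg_cong[OF eqL, of "\<lambda>u. 2 *\<^sub>R blinfun_apply u v"] by (simp add: blinfun.bilinear_simps)
    then show "((id_blinfun - L) o\<^sub>L (id_blinfun - L)) v = (id_blinfun - T) v"
      by (simp add: blinfun.bilinear_simps scaleR_2 algebra_simps)
  qed
  ultimately show ?thesis using LM by blast
qed

text \<open>R = r sqrt(1 - T) with T = 1 - (h/r)^2 is the modulus of h. Its positivity follows from
  norm S \<le> 1, since R = r (1 - S).\<close>

lemma abs_exists:
  assumes h: "h \<in> M" "is_adjoint h h"
  shows "\<exists>R\<in>M. (\<forall>v. 0 \<le> Re (cinner v (blinfun_apply R v))) \<and> R o\<^sub>L R = h o\<^sub>L h"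
proof -
  \<comment> \<open>The summand 1 keeps r positive when h = 0.\<close>
  define r where "r = norm h + 1"
  have r: "0 < r" by (simp add: r_def add_nonneg_pos)
  define g where "g = (1 / r) *\<^sub>R h"
  have g: "g \<in> M" "is_adjoint g g" using h by (auto simp: g_def is_adjoint_scaleR_self)
  have "norm g = norm h / r" using r by (simp add: g_def)
  then have "norm g \<le> 1" using r by (simp add: r_def)
  then have ng: "norm (g v) \<le> norm v" for v
    using norm_blinfun[of g v] mult_right_mono[of "norm g" 1 "norm v"] by simp
  define T where "T = id_blinfun - (g o\<^sub>L g)"
  have "norm (T v) \<le> 1 * norm v" for v
  proof -
    have "(norm (T v))\<^sup>2 = (norm v)\<^sup>2 - 2 * Re (cinner (g v) (g v)) + (norm (g (g v)))\<^sup>2"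
      by (simp add: T_def blinfun.bilinear_simps norm_diff_sq is_adjointD[OF g(2)])
    also have "\<dots> = (norm v)\<^sup>2 - 2 * (norm (g v))\<^sup>2 + (norm (g (g v)))\<^sup>2"
      by (simp only: cinner_self Re_complex_of_real)
    also have "\<dots> \<le> (norm v)\<^sup>2 - (norm (g v))\<^sup>2"
      using ng[of "g v"] by (simp add: power_mono)
    also have "\<dots> \<le> (norm v)\<^sup>2" by simp
    finally have "norm (T v) \<le> norm v" by (rule power2_le_imp_le) simp
    then show ?thesis by simp
  qed
  then have "norm T \<le> 1" by (intro norm_blinfun_bound) auto
  moreover have "T \<in> M" "is_adjoint T T"
    using g by (auto simp: T_def is_adjoint_diff_self is_adjoint_id is_adjoint_square_self)
  ultimately obtain S where S: "S \<in> M" "norm S \<le> 1"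
    and sq: "(id_blinfun - S) o\<^sub>L (id_blinfun - S) = id_blinfun - T"
    using sqrt_exists by blast
  define R where "R = r *\<^sub>R (id_blinfun - S)"
  have "R o\<^sub>L R = h o\<^sub>L h"
  proof (rule blinfun_eqI)
    fix v
    have "R (R v) = (r * r) *\<^sub>R ((id_blinfun - S) o\<^sub>L (id_blinfun - S)) v"
      by (simp add: R_def blinfun.scaleR_left blinfun.scaleR_right)
    also have "\<dots> = (r * r) *\<^sub>R g (g v)"
      unfolding sq by (simp add: T_def blinfun.bilinear_simps)
    also have "\<dots> = h (h v)" using r by (simp add: g_def blinfun.bilinear_simps)
    finally show "(R o\<^sub>L R) v = (h o\<^sub>L h) v" by simp
  qed
  moreover have "0 \<le> Re (cinner v (R v))" for v
  proof -
    have "Re (cinner v (S v)) \<le> norm v * norm (S v)" by (rule Re_cinner_le)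
    also have "\<dots> \<le> norm v * (1 * norm v)"
      using S(2) by (intro mult_left_mono order_trans[OF norm_blinfun] mult_right_mono) auto
    finally have "0 \<le> (norm v)\<^sup>2 - Re (cinner v (S v))" by (simp add: power2_eq_square)
    also have "\<dots> = Re (cinner v (v - S v))"
      unfolding cinner_diff_right cinner_self by simp
    finally have "0 \<le> r * Re (cinner v (v - S v))" using r by simp
    then show ?thesis by (simp add: R_def blinfun.bilinear_simps cinner_scaleR_right)
  qed
  moreover have "R \<in> M" using S by (simp add: R_def M_scaleR)
  ultimately show ?thesis by blast
qed

text \<open>A contraction with a contractive inverse is unitary. This form provides the norm bounds
  and the inverse that the powers of w require, without mentioning adjoints.\<close>

definition unitaries :: "('a \<Rightarrow>\<^sub>L 'a) set" where
  "unitaries = {w \<in> M. \<exists>w'\<in>M. w o\<^sub>L w' = id_blinfun \<and> norm w \<le> 1 \<and> norm w' \<le> 1}"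

text \<open>The unitaries are u + i sqrt(1 - u^2) and u - i sqrt(1 - u^2), as a cosine is the mean
  of two conjugate points of the unit circle.\<close>

lemma self_adjoint_eq_unitaries:
  assumes u: "u \<in> M" "is_adjoint u u" "norm u \<le> 1"
  shows "\<exists>w\<in>unitaries. \<exists>w'\<in>unitaries. u = scaleC_blinfun (1/2) (w + w')"
proof -
  have "norm (u o\<^sub>L u) \<le> 1"
    using norm_blinfun_compose[of u u] mult_le_one[of "norm u" "norm u"] u(3) by simp
  then obtain S where S: "S \<in> M" "is_adjoint S S"
    and sq: "(id_blinfun - S) o\<^sub>L (id_blinfun - S) = id_blinfun - (u o\<^sub>L u)"
    using sqrt_exists[of "u o\<^sub>L u"] u by (auto simp: is_adjoint_square_self)
  define r where "r = id_blinfun - S"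
  have r: "r \<in> M" "is_adjoint r r"
    using S by (auto simp: r_def is_adjoint_diff_self is_adjoint_id)
  have rr: "r (r v) = v - u (u v)" for v
    using arg_cong[OF sq, of "\<lambda>q. blinfun_apply q v"] unfolding r_def[symmetric]
    by (simp add: blinfun.bilinear_simps)
  have ru: "r (u v) = u (r v)" for v by (rule M_commute[OF r(1) u(1)])
  \<comment> \<open>k stands for i or -i. From k k = -1 and \<open>cnj k = - k\<close>,
    \<open>W (- k)\<close> is at once inverse and adjoint of \<open>W k\<close>.\<close>
  define W where "W k = u + scaleC_blinfun k r" for k
  have WM: "W k \<in> M" for k using u r by (auto simp: W_def)
  have inv: "W k (W (- k) v) = v" if "k * k = - 1" for k v
    using that
    by (simp add: W_def blinfun.bilinear_simps M_scale u r scaleC_add_right scaleC_scaleC rr ru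
        scaleC_diff_right flip: minus_mult_left)
      (simp flip: scaleC_add_left)
  have adj: "cinner (W k v) y = cinner v (W (- k) y)" if "cnj k = - k" for k v y
    using that by (simp add: W_def blinfun.bilinear_simps cinner_simps is_adjointD[OF u(2)]
        is_adjointD[OF r(2)])
  have nW: "norm (W k) \<le> 1" if k: "k * k = - 1" "cnj k = - k" for k
  proof (rule norm_blinfun_bound)
    fix v
    have "cinner (W k v) (W k v) = cinner v (W (- k) (W k v))" by (rule adj[OF k(2)])
    also have "W (- k) (W k v) = v" using inv[of "- k" v] k(1) by simp
    finally have "norm (W k v) = norm v"
      unfolding cinner_self of_real_eq_iff by (simp add: power2_eq_iff_nonneg)
    then show "norm (W k v) \<le> 1 * norm v" by simp
  qed simp
  have "W k \<in> unitaries" if k: "k * k = - 1" "cnj k = - k" for k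
  proof -
    have "W k o\<^sub>L W (- k) = id_blinfun" by (rule blinfun_eqI) (simp add: inv k)
    moreover have "norm (W (- k)) \<le> 1" using nW[of "- k"] k by simp
    ultimately show ?thesis using nW[OF k] WM unfolding unitaries_def by blast
  qed
  then have "W \<i> \<in> unitaries" "W (- \<i>) \<in> unitaries" by simp_all
  moreover have "u = scaleC_blinfun (1/2) (W \<i> + W (- \<i>))"
  proof (rule blinfun_eqI)
    fix v
    have "(W \<i> + W (- \<i>)) v = u v + u v"
      using scaleC_add_left[of \<i> "- \<i>" "r v"]
      by (simp add: W_def blinfun.bilinear_simps algebra_simps)
    then have "scaleC_blinfun (1/2) (W \<i> + W (- \<i>)) v = (1/2) *\<^sub>C (u v + u v)"
      by simp
    also have "\<dots> = u v"
      using scaleC_add_left[of "1/2" "1/2" "u v"] by (simp add: scaleC_add_right)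
    finally show "u v = scaleC_blinfun (1/2) (W \<i> + W (- \<i>)) v" by simp
  qed
  ultimately show ?thesis by blast
qed

lemma self_adjoint_parts:
  assumes u: "u \<in> M"
  shows "\<exists>h\<in>M. \<exists>k\<in>M. is_adjoint h h \<and> is_adjoint k k \<and> u = h + scaleC_blinfun \<i> k"
proof -
  obtain s where s: "s \<in> M" "is_adjoint u s" using M_adjoint u by blast
  define h k where "h = scaleC_blinfun (1/2) (u + s)" and "k = scaleC_blinfun (- \<i>/2) (u - s)"
  have "h \<in> M" "k \<in> M" using u s by (simp_all add: h_def k_def)
  moreover have "is_adjoint h h" "is_adjoint k k"
    unfolding is_adjoint_def h_def k_def
    by (simp_all add: blinfun.bilinear_simps cinner_simps is_adjointD[OF s(2)]
        is_adjointD[OF is_adjoint_commute[OF s(2)]] algebra_simps)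
  moreover have "u = h + scaleC_blinfun \<i> k"
  proof (rule blinfun_eqI)
    fix v
    have "u v = (1/2) *\<^sub>C u v + (1/2) *\<^sub>C u v" using scaleC_add_left[of "1/2" "1/2" "u v"] by simp
    then show "u v = (h + scaleC_blinfun \<i> k) v"
      by (simp add: h_def k_def blinfun.bilinear_simps scaleC_scaleC scaleC_add_right
          scaleC_diff_right)
  qed
  ultimately show ?thesis by blast
qed

text \<open>For every real \<open>r\<close> the positive and negative parts of \<open>h - r\<close> are disjoint, so one of them
  vanishes on the range of \<open>e\<close>.\<close>

lemma self_adjoint_scalar_on_range:
  assumes e: "e \<in> M" and h: "h \<in> M" "is_adjoint h h"
    and indec: "\<And>f g. f \<in> M \<Longrightarrow> g \<in> M \<Longrightarrow> f o\<^sub>L g = 0 \<Longrightarrow> f o\<^sub>L e = 0 \<or> g o\<^sub>L e = 0"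
  shows "\<exists>r::real. \<forall>v. blinfun_apply h (e v) = r *\<^sub>R e v"
proof -
  let ?q = "\<lambda>v. Re (cinner (e v) (h (e v)))"
  have alt: "(\<forall>v. ?q v \<le> r * (norm (e v))\<^sup>2) \<or> (\<forall>v. r * (norm (e v))\<^sup>2 \<le> ?q v)" for r :: real
  proof -
    define k where "k = h - r *\<^sub>R id_blinfun"
    have k: "k \<in> M" "is_adjoint k k"
      using h by (auto simp: k_def M_scaleR is_adjoint_diff_self is_adjoint_scaleR_self
          is_adjoint_id)
    obtain R where R: "R \<in> M" "\<And>v. 0 \<le> Re (cinner v (blinfun_apply R v))" "R o\<^sub>L R = k o\<^sub>L k"
      using abs_exists[OF k] by blast
    have q: "Re (cinner (e v) (k (e v))) = ?q v - r * (norm (e v))\<^sup>2" for v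
      by (simp add: k_def blinfun.bilinear_simps cinner_diff_right cinner_scaleR_right cinner_self
          del: of_real_power)
    have RR: "R (R v) = k (k v)" for v
      using arg_cong[OF R(3), of "\<lambda>q. blinfun_apply q v"] by simp
    \<comment> \<open>With R the modulus of k, R + k and R - k are twice the positive and negative
      parts of k.\<close>
    have "(R + k) o\<^sub>L (R - k) = 0"
      by (rule blinfun_eqI) (simp add: blinfun.bilinear_simps RR M_commute[OF R(1) k(1)])
    then consider "(R + k) o\<^sub>L e = 0" | "(R - k) o\<^sub>L e = 0"
      using indec[of "R + k" "R - k"] R k by auto
    then show ?thesis
    proof cases
      case 1
      have "?q v \<le> r * (norm (e v))\<^sup>2" for v
      proof -
        have "k (e v) = - R (e v)"
          using arg_cong[OF 1, of "\<lambda>q. blinfun_apply q v"]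
          by (simp add: blinfun.bilinear_simps eq_neg_iff_add_eq_0 add.commute)
        then show ?thesis using q[of v] R(2)[of "e v"] by (simp add: cinner_minus_right)
      qed
      then show ?thesis by blast
    next
      case 2
      have "r * (norm (e v))\<^sup>2 \<le> ?q v" for v
      proof -
        have "k (e v) = R (e v)"
          using arg_cong[OF 2, of "\<lambda>q. blinfun_apply q v"] by (simp add: blinfun.bilinear_simps)
        then show ?thesis using q[of v] R(2)[of "e v"] by simp
      qed
      then show ?thesis by blast
    qed
  qed
  show ?thesis
  proof (cases "e = 0")
    case False
    then obtain v0 where v0: "e v0 \<noteq> 0" by (metis blinfun_eqI zero_blinfun.rep_eq)
    \<comment> \<open>The Rayleigh quotient of h at e v0. At r + t the vector v0 excludes the lower
      bound in \<open>alt\<close>, at r - t the upper one; letting t tend to 0 leaves equality for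
      every v.\<close>
    define r where "r = ?q v0 / (norm (e v0))\<^sup>2"
    have n0: "0 < (norm (e v0))\<^sup>2" using v0 by simp
    have q0: "?q v0 = r * (norm (e v0))\<^sup>2" using n0 by (simp add: r_def)
    have small: "\<exists>t>0. t * a \<le> d" if "0 \<le> a" "0 < d" for a d :: real
      using that by (intro exI[of _ "d / (a + 1)"]) (auto simp: field_simps)
    have eq: "?q v = r * (norm (e v))\<^sup>2" for v
    proof (rule antisym)
      show "?q v \<le> r * (norm (e v))\<^sup>2"
      proof (rule field_le_epsilon)
        fix d :: real assume d: "0 < d"
        obtain t where t: "0 < t" "t * (norm (e v))\<^sup>2 \<le> d"
          using small[OF _ d] zero_le_power2 by blast
        have "\<not> (r + t) * (norm (e v0))\<^sup>2 \<le> ?q v0"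
          unfolding q0 distrib_right using mult_pos_pos[OF t(1) n0] by linarith
        then have "?q v \<le> (r + t) * (norm (e v))\<^sup>2" using alt[of "r + t"] by blast
        then show "?q v \<le> r * (norm (e v))\<^sup>2 + d" using t(2) by (simp add: distrib_right)
      qed
      show "r * (norm (e v))\<^sup>2 \<le> ?q v"
      proof (rule field_le_epsilon)
        fix d :: real assume d: "0 < d"
        obtain t where t: "0 < t" "t * (norm (e v))\<^sup>2 \<le> d"
          using small[OF _ d] zero_le_power2 by blast
        have "\<not> ?q v0 \<le> (r - t) * (norm (e v0))\<^sup>2"
          unfolding q0 left_diff_distrib using mult_pos_pos[OF t(1) n0] by linarith
        then have "(r - t) * (norm (e v))\<^sup>2 \<le> ?q v" using alt[of "r - t"] by blast
        then show "r * (norm (e v))\<^sup>2 \<le> ?q v + d" using t(2) by (simp add: left_diff_distrib)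
      qed
    qed
    define k where "k = h - r *\<^sub>R id_blinfun"
    have k: "k \<in> M" "is_adjoint k k"
      using h by (auto simp: k_def M_scaleR is_adjoint_diff_self is_adjoint_scaleR_self
          is_adjoint_id)
    have zero: "Re (cinner (e v) (k (e v))) = 0" for v
      using eq[of v]
      by (simp add: k_def blinfun.bilinear_simps cinner_diff_right cinner_scaleR_right cinner_self
          del: of_real_power)
    \<comment> \<open>The quadratic form of k vanishes on the range of e, which k preserves;
      evaluating it at y + k y leaves 2 |k y|^2.\<close>
    have "k (e v) = 0" for v
    proof -
      let ?y = "e v"
      have ek: "e (k v) = k ?y" by (rule M_commute[OF e k(1)])
      have "0 = Re (cinner (?y + k ?y) (k (?y + k ?y)))"
        using zero[of "v + k v"] by (simp add: blinfun.add_right ek)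
      also have "\<dots> = Re (cinner ?y (k ?y)) + 2 * Re (cinner (k ?y) (k ?y))
          + Re (cinner (k ?y) (k (k ?y)))"
        by (simp add: blinfun.add_right cinner_simps flip: is_adjointD[OF k(2), of ?y "k ?y"])
      also have "\<dots> = 2 * (norm (k ?y))\<^sup>2"
        using zero[of v] zero[of "k v"] unfolding ek by (simp add: cinner_self del: of_real_power)
      finally show ?thesis by simp
    qed
    then have "h (e v) = r *\<^sub>R e v" for v
      by (simp add: k_def blinfun.bilinear_simps)
    then show ?thesis by blast
  qed (auto intro!: exI[of _ 0])
qed

text \<open>Under \<open>indec\<close>, e behaves like a multiple of a minimal projection. The
  self-adjoint parts of u are scalars on its range, hence so is u.\<close>

lemma scalar_on_range:
  assumes e: "e \<in> M" and u: "u \<in> M"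
    and indec: "\<And>f g. f \<in> M \<Longrightarrow> g \<in> M \<Longrightarrow> f o\<^sub>L g = 0 \<Longrightarrow> f o\<^sub>L e = 0 \<or> g o\<^sub>L e = 0"
  shows "\<exists>z. (u - scaleC_blinfun z id_blinfun) o\<^sub>L e = 0"
proof -
  obtain h k where hk: "h \<in> M" "k \<in> M" "is_adjoint h h" "is_adjoint k k"
    and u_eq: "u = h + scaleC_blinfun \<i> k" using self_adjoint_parts[OF u] by blast
  obtain r s :: real where "\<And>v. h (e v) = r *\<^sub>R e v" "\<And>v. k (e v) = s *\<^sub>R e v"
    using self_adjoint_scalar_on_range[OF e hk(1,3) indec]
      self_adjoint_scalar_on_range[OF e hk(2,4) indec] by metis
  then have "(u - scaleC_blinfun (Complex r s) id_blinfun) o\<^sub>L e = 0"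
    by (intro blinfun_eqI)
      (simp add: u_eq blinfun.bilinear_simps Complex_eq scaleC_add_left scaleC_scaleC
        flip: scaleC_of_real)
  then show ?thesis by blast
qed

end

section \<open>Derivations into Banach bimodules\<close>

definition opow :: "('a::chilbert_space \<Rightarrow>\<^sub>L 'a) \<Rightarrow> nat \<Rightarrow> ('a \<Rightarrow>\<^sub>L 'a)" where
  "opow u n = ((o\<^sub>L) u ^^ n) id_blinfun"

lemma opow_0 [simp]: "opow u 0 = id_blinfun"
  by (simp add: opow_def)

lemma opow_Suc [simp]: "opow u (Suc n) = u o\<^sub>L opow u n"
  by (simp add: opow_def)

lemma blinfun_compose_assoc: "(u o\<^sub>L v) o\<^sub>L w = u o\<^sub>L (v o\<^sub>L w)"
  by (rule blinfun_eqI) simp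

lemma id_blinfun_compose [simp]: "id_blinfun o\<^sub>L u = u" "u o\<^sub>L id_blinfun = u"
  by (rule blinfun_eqI; simp)+

text \<open>Only an inequality, because the identity of the zero space has norm 0.\<close>

lemma norm_id_blinfun_le: "norm (id_blinfun :: 'a::real_normed_vector \<Rightarrow>\<^sub>L 'a) \<le> 1"
  by (rule norm_blinfun_bound) simp_all

lemma norm_opow_le: "norm u \<le> 1 \<Longrightarrow> norm (opow u n) \<le> 1"
proof (induction n)
  case (Suc n)
  then have "norm u * norm (opow u n) \<le> 1" by (simp add: mult_le_one)
  then show ?case using norm_blinfun_compose[of u "opow u n"] by simp
qed (simp add: norm_id_blinfun_le)

lemma scaleC_of_real_blinfun: "scaleC_blinfun (complex_of_real r) u = r *\<^sub>R u"
  by (rule blinfun_eqI) (simp add: scaleC_of_real blinfun.scaleR_left)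

lemma (in commutative_von_neumann_algebra) M_opow: "u \<in> M \<Longrightarrow> opow u n \<in> M"
  by (induction n) simp_all

section \<open>The bimodule in terms of numerators\<close>

locale bimodule_derivation = commutative_von_neumann_algebra M
  for M :: "('a::chilbert_space \<Rightarrow>\<^sub>L 'a) set" +
  fixes \<tau> :: "('a \<Rightarrow>\<^sub>L 'a) \<Rightarrow> ennreal" and E :: "'a operator set"
    and N :: "'a operator \<Rightarrow> real" and \<delta> :: "('a \<Rightarrow>\<^sub>L 'a) \<Rightarrow> 'a operator"
  assumes bimodule: "banach_bimodule M \<tau> E N" and deriv: "derivation M E \<delta>"
begin

lemma E_frac:
  assumes "x \<in> E"
  shows "\<exists>b\<in>denominators. \<exists>c\<in>M. x = frac b c"
  using assms bimodule unfolding banach_bimodule_def tau_measurable_def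
  by (intro affiliated_eq_frac) auto

text \<open>Multiply the denominators, expanding each numerator by the others. Finite sets suffice,
  as the gliding hump compares four values of \<delta> at a time.\<close>

lemma common_denominator:
  "finite A \<Longrightarrow> A \<subseteq> E \<Longrightarrow> \<exists>b\<in>denominators. \<forall>x\<in>A. \<exists>c\<in>M. x = frac b c"
proof (induction A rule: finite_induct)
  case empty
  then show ?case using denominators_id by blast
next
  case (insert x A)
  then obtain b where b: "b \<in> denominators" and A: "\<And>y. y \<in> A \<Longrightarrow> \<exists>c\<in>M. y = frac b c"
    by auto
  obtain d c where d: "d \<in> denominators" and c: "c \<in> M" "x = frac d c"
    using E_frac insert.prems by blast
  have "x = frac (d o\<^sub>L b) (b o\<^sub>L c)"
    using frac_expand[OF d c(1) b] c M_compose_commute[OF denominators_M[OF b] denominators_M[OF d]]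
    by simp
  moreover have "\<exists>c\<in>M. y = frac (d o\<^sub>L b) c" if "y \<in> A" for y
    using A[OF that] frac_expand[OF b _ d] denominators_M[OF d] M_compose by metis
  ultimately show ?case
    using denominators_compose[OF d b] c denominators_M[OF b] M_compose
    by (intro bexI[of _ "d o\<^sub>L b"]) auto
qed

lemma E_add:
  assumes "b \<in> denominators" "c \<in> M" "d \<in> M" "frac b c \<in> E" "frac b d \<in> E"
  shows "frac b (c + d) \<in> E" "N (frac b (c + d)) \<le> N (frac b c) + N (frac b d)"
  using bimodule assms strong_add_frac[OF assms(1-3)]
  unfolding banach_bimodule_def linear_subspace_def is_norm_on_def by metis+

lemma E_scale:
  assumes "b \<in> denominators" "c \<in> M" "frac b c \<in> E"
  shows "frac b (scaleC_blinfun k c) \<in> E" "N (frac b (scaleC_blinfun k c)) = cmod k * N (frac b c)"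
  using bimodule assms strong_scale_frac[OF assms(1,2)]
  unfolding banach_bimodule_def linear_subspace_def is_norm_on_def by metis+

lemma E_diff:
  assumes "b \<in> denominators" "c \<in> M" "d \<in> M" "frac b c \<in> E" "frac b d \<in> E"
  shows "frac b (c - d) \<in> E" "N (frac b (c - d)) \<le> N (frac b c) + N (frac b d)"
proof -
  have eq: "c - d = c + scaleC_blinfun (- 1) d"
    by (rule blinfun_eqI) (simp add: blinfun.bilinear_simps)
  note s = E_scale[OF assms(1,3,5), of "- 1"]
  show "frac b (c - d) \<in> E" "N (frac b (c - d)) \<le> N (frac b c) + N (frac b d)"
    unfolding eq using E_add[OF assms(1,2) M_scaleC[OF assms(3)] assms(4) s(1)] s(2) by simp_all
qed

text \<open>The two-sided bimodule estimate with the identity as right factor.\<close>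

lemma E_mult:
  assumes "b \<in> denominators" "c \<in> M" "u \<in> M" "frac b c \<in> E"
  shows "frac b (u o\<^sub>L c) \<in> E" "N (frac b (u o\<^sub>L c)) \<le> norm u * N (frac b c)"
proof -
  let ?x = "strong_mult (strong_mult (of_bounded u) (frac b c)) (of_bounded id_blinfun)"
  have x: "?x = frac b (u o\<^sub>L c)"
    using assms by (simp add: strong_mult_left_frac strong_mult_right_frac M_compose)
  have "?x \<in> E" "N ?x \<le> norm u * norm (id_blinfun :: 'a \<Rightarrow>\<^sub>L 'a) * N (frac b c)"
    using bimodule assms(3,4) M_id unfolding banach_bimodule_def by blast+
  moreover have "0 \<le> N (frac b c)"
    using bimodule assms(4) unfolding banach_bimodule_def is_norm_on_def by blast
  then have "norm u * norm (id_blinfun :: 'a \<Rightarrow>\<^sub>L 'a) * N (frac b c) \<le> norm u * N (frac b c)"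
    using norm_id_blinfun_le[where 'a = 'a]
    by (intro mult_right_mono) (auto intro: mult_left_le)
  ultimately show "frac b (u o\<^sub>L c) \<in> E" "N (frac b (u o\<^sub>L c)) \<le> norm u * N (frac b c)"
    unfolding x by auto
qed

lemma N_nonneg: "x \<in> E \<Longrightarrow> 0 \<le> N x"
  using bimodule unfolding banach_bimodule_def is_norm_on_def by blast

lemma N_pos:
  assumes "b \<in> denominators" "c \<in> M" "c \<noteq> 0" "frac b c \<in> E"
  shows "0 < N (frac b c)"
proof -
  have "frac b c \<noteq> of_bounded 0"
    using assms frac_inject[OF assms(1,2) M_zero] of_bounded_0_eq_frac[OF assms(1)] by simp
  then show ?thesis
    using bimodule assms(4) unfolding banach_bimodule_def is_norm_on_def by force
qed

section \<open>The derivation in terms of numerators\<close>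

lemma \<delta>_in: "u \<in> M \<Longrightarrow> \<delta> u \<in> E"
  using deriv by (simp add: derivation_def)

lemma \<delta>_mult:
  assumes "b \<in> denominators" "c \<in> M" "d \<in> M" "u \<in> M" "w \<in> M" "\<delta> u = frac b c" "\<delta> w = frac b d"
  shows "\<delta> (u o\<^sub>L w) = frac b ((w o\<^sub>L c) + (u o\<^sub>L d))"
proof -
  have "\<delta> (u o\<^sub>L w)
      = strong_add (strong_mult (\<delta> u) (of_bounded w)) (strong_mult (of_bounded u) (\<delta> w))"
    using deriv assms(4,5) unfolding derivation_def by blast
  then show ?thesis
    using assms by (simp add: strong_mult_left_frac strong_mult_right_frac strong_add_frac M_compose)
qed

lemma \<delta>_add:
  assumes "b \<in> denominators" "c \<in> M" "d \<in> M" "u \<in> M" "w \<in> M" "\<delta> u = frac b c" "\<delta> w = frac b d"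
  shows "\<delta> (u + w) = frac b (c + d)"
  using deriv assms strong_add_frac[OF assms(1-3)] unfolding derivation_def by metis

lemma \<delta>_scale:
  assumes "b \<in> denominators" "c \<in> M" "u \<in> M" "\<delta> u = frac b c"
  shows "\<delta> (scaleC_blinfun k u) = frac b (scaleC_blinfun k c)"
  using deriv assms strong_scale_frac[OF assms(1,2)] unfolding derivation_def by metis

lemma \<delta>_zero:
  assumes "b \<in> denominators"
  shows "\<delta> 0 = frac b 0"
proof -
  obtain d c where dc: "d \<in> denominators" "c \<in> M" "\<delta> 0 = frac d c"
    using E_frac[OF \<delta>_in[OF M_zero]] by blast
  have z: "scaleC_blinfun 0 u = 0" for u :: "'a \<Rightarrow>\<^sub>L 'a"
    by (rule blinfun_eqI) simp
  have "\<delta> 0 = frac d 0" using \<delta>_scale[OF dc(1,2) M_zero dc(3), of 0] by (simp add: z)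
  then show ?thesis using of_bounded_0_eq_frac dc(1) assms by metis
qed

lemma \<delta>_id:
  assumes "b \<in> denominators"
  shows "\<delta> id_blinfun = frac b 0"
proof -
  obtain d c where dc: "d \<in> denominators" "c \<in> M" "\<delta> id_blinfun = frac d c"
    using E_frac[OF \<delta>_in[OF M_id]] by blast
  have "frac d c = frac d (c + c)"
    using \<delta>_mult[OF dc(1,2,2) M_id M_id dc(3,3)] dc(3) by simp
  then have "c = c + c" using frac_inject[OF dc(1,2) M_add[OF dc(2,2)]] by blast
  then have "c = 0" by simp
  then show ?thesis using of_bounded_0_eq_frac dc assms by metis
qed

lemma \<delta>_opow:
  assumes "b \<in> denominators" "c \<in> M" "w \<in> M" "\<delta> w = frac b c"
  shows "\<delta> (opow w (Suc k)) = frac b (real (Suc k) *\<^sub>R (opow w k o\<^sub>L c))"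
proof (induction k)
  case 0
  then show ?case using assms by simp
next
  case (Suc k)
  let ?d = "real (Suc k) *\<^sub>R (opow w k o\<^sub>L c)"
  have "\<delta> (opow w (Suc (Suc k))) = frac b ((opow w (Suc k) o\<^sub>L c) + (w o\<^sub>L ?d))"
    unfolding opow_Suc[of w "Suc k"]
    by (rule \<delta>_mult[OF assms(1,2) _ assms(3) _ assms(4) Suc])
      (simp_all only: M_scaleR M_compose M_opow assms)
  also have "(opow w (Suc k) o\<^sub>L c) + (w o\<^sub>L ?d) = real (Suc (Suc k)) *\<^sub>R (opow w (Suc k) o\<^sub>L c)"
    by (rule blinfun_eqI) (simp add: blinfun.bilinear_simps scaleR_2 algebra_simps)
  finally show ?case .
qed

text \<open>If \<open>(w - z) e = 0\<close>, then \<open>0 = \<delta>((w - z) e)\<close> gives \<open>e\<^sup>2 \<delta>(w) = 0\<close>.\<close>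

lemma numerator_vanishes_if_scalar:
  assumes b: "b \<in> denominators" and c: "c \<in> M" and w: "w \<in> M" and \<delta>w: "\<delta> w = frac b c"
    and a: "a \<in> M" and scalar: "(w - scaleC_blinfun z id_blinfun) o\<^sub>L (a o\<^sub>L c) = 0"
  shows "a o\<^sub>L c = 0"
proof -
  define e where "e = a o\<^sub>L c"
  \<comment> \<open>Subtracting the scalar z leaves \<delta> unchanged, since \<delta> kills the
    identity.\<close>
  define g where "g = w + scaleC_blinfun (- z) id_blinfun"
  have e: "e \<in> M" and g: "g \<in> M" using a c w by (auto simp: e_def g_def)
  have "g = w - scaleC_blinfun z id_blinfun"
    unfolding g_def using scaleC_add_left[of z "- z"]
    by (intro blinfun_eqI) (simp add: blinfun.bilinear_simps eq_neg_iff_add_eq_0 add.commute)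
  then have ge: "g o\<^sub>L e = 0" using scalar by (simp add: e_def)
  obtain b1 d where b1: "b1 \<in> denominators" "d \<in> M" "\<delta> e = frac b1 d"
    using E_frac[OF \<delta>_in[OF e]] by blast
  note bM = denominators_M[OF b] and b1M = denominators_M[OF b1(1)]
  have s0: "scaleC_blinfun k 0 = 0" for k by (rule blinfun_eqI) simp
  have "\<delta> g = frac b c"
    unfolding g_def
    using \<delta>_add[OF b c M_scaleC[OF M_zero] w M_scaleC[OF M_id] \<delta>w
        \<delta>_scale[OF b M_zero M_id \<delta>_id[OF b]], of "- z"] by (simp add: s0)
  then have dg: "\<delta> g = frac (b1 o\<^sub>L b) (b1 o\<^sub>L c)" using frac_expand[OF b c b1(1)] by simp
  have de: "\<delta> e = frac (b1 o\<^sub>L b) (b o\<^sub>L d)"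
    using frac_expand[OF b1(1,2) b] b1(3) M_compose_commute[OF bM b1M] by simp
  have B: "b1 o\<^sub>L b \<in> denominators" using denominators_compose b b1 by blast
  have "\<delta> (g o\<^sub>L e) = frac (b1 o\<^sub>L b) ((e o\<^sub>L (b1 o\<^sub>L c)) + (g o\<^sub>L (b o\<^sub>L d)))"
    using \<delta>_mult[OF B _ _ g e dg de] b1M bM b1 c by (simp add: M_compose)
  then have "frac (b1 o\<^sub>L b) 0 = frac (b1 o\<^sub>L b) ((e o\<^sub>L (b1 o\<^sub>L c)) + (g o\<^sub>L (b o\<^sub>L d)))"
    using ge \<delta>_zero[OF B] by simp
  then have eq: "(e o\<^sub>L (b1 o\<^sub>L c)) + (g o\<^sub>L (b o\<^sub>L d)) = 0"
    using frac_inject[OF B M_zero] e g b1M bM b1 c by (metis M_add M_compose)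
  \<comment> \<open>Applying e to \<open>eq\<close> removes the g term because e g = 0; cancelling
    the injective b1 leaves e^2 c = 0.\<close>
  have "e (e (c v)) = 0" for v
  proof -
    have "e (e (b1 (c v)) + g (b (d v))) = 0"
      using arg_cong[OF eq, of "\<lambda>q. blinfun_apply q v"] by (simp add: blinfun.bilinear_simps)
    moreover have "e (g y) = 0" for y
      using arg_cong[OF ge, of "\<lambda>q. blinfun_apply q y"] M_commute[OF e g] by simp
    ultimately have "e (e (b1 (c v))) = 0" by (simp add: blinfun.add_right)
    then have "b1 (e (e (c v))) = 0" by (simp add: M_commute[OF b1M e])
    then show ?thesis using denominators_cancel_0 b1(1) by blast
  qed
  then have "e (e (a (c v))) = 0" for v
    by (simp only: M_commute[OF e a] blinfun.zero_right)
  moreover have "e v = a (c v)" for v by (simp add: e_def)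
  ultimately have eee: "e (e (e v)) = 0" for v by metis
  \<comment> \<open>Only squares can be cancelled, so e^3 = 0 is used in the form (e^2)^2 = 0 and
    \<open>M_reduced\<close> is applied twice.\<close>
  have "(e o\<^sub>L e) o\<^sub>L (e o\<^sub>L e) = 0" by (rule blinfun_eqI) (simp add: eee)
  then have "e o\<^sub>L e = 0" using M_reduced e by blast
  then have "e = 0" using M_reduced e by blast
  then show ?thesis by (simp add: e_def)
qed

text \<open>A gliding hump: \<open>\<delta>\<close> of \<open>\<Sum> f\<^sub>n w\<^sup>k\<close> with \<open>k = k\<^sub>n\<close> growing fast would have infinite norm,
  because multiplication by \<open>f\<^sub>n\<close> isolates the \<open>n\<close>-th summand and \<open>\<delta>(w\<^sup>k)\<close> carries the factor \<open>k\<close>.\<close>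

lemma no_disjoint_sequence:
  assumes w: "w \<in> unitaries" and b: "b \<in> denominators" and c: "c \<in> M" and \<delta>w: "\<delta> w = frac b c"
    and qM: "\<And>n::nat. q n \<in> M" and disj: "\<And>m n. m \<noteq> n \<Longrightarrow> q m o\<^sub>L q n = 0"
    and qc: "\<And>n. q n o\<^sub>L c \<noteq> 0"
  shows False
proof -
  obtain w' where wM: "w \<in> M" and w': "w' \<in> M" "w o\<^sub>L w' = id_blinfun" "norm w \<le> 1" "norm w' \<le> 1"
    using w by (auto simp: unitaries_def)
  \<comment> \<open>Weights that bound the norm of \<open>f n\<close> by 2^-n and so make the hump
    converge; the summand 1 avoids division by zero.\<close>
  define s where "s n = (1/2)^n / (1 + norm (q n))" for n
  have s: "0 < s n" for n by (simp add: s_def add_pos_nonneg)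
  define f where "f n = s n *\<^sub>R q n" for n
  have f: "f n \<in> M" for n by (simp add: f_def qM M_scaleR)
  have nf: "norm (f n) \<le> (1/2)^n" for n
  proof -
    have "norm (f n) = (1/2)^n * (norm (q n) / (1 + norm (q n)))"
      by (simp add: f_def s_def abs_of_pos add_pos_nonneg)
    also have "\<dots> \<le> (1/2)^n * 1"
      by (intro mult_left_mono) (simp_all add: divide_le_eq add_pos_nonneg)
    finally show ?thesis by simp
  qed
  have fdisj: "f m (f n v) = 0" if "m \<noteq> n" for m n v
    using arg_cong[OF disj[OF that], of "\<lambda>q. blinfun_apply q v"]
    by (simp add: f_def blinfun.bilinear_simps)
  \<comment> \<open>The square appears because the isolating factor \<open>f n\<close> meets the
    \<open>f n\<close> of the summand. If f^2 c = 0, then (f c)^2 = 0, hence f c = 0.\<close>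
  have ffc: "(f n o\<^sub>L f n) o\<^sub>L c \<noteq> 0" for n
  proof
    assume ffc0: "(f n o\<^sub>L f n) o\<^sub>L c = 0"
    have "(f n o\<^sub>L c) o\<^sub>L (f n o\<^sub>L c) = 0"
    proof (rule blinfun_eqI)
      fix v
      have "f n (c (f n (c v))) = f n (f n (c (c v)))" using M_commute[OF c f] by simp
      also have "\<dots> = 0" using arg_cong[OF ffc0, of "\<lambda>q. blinfun_apply q (c v)"] by simp
      finally show "((f n o\<^sub>L c) o\<^sub>L (f n o\<^sub>L c)) v = blinfun_apply 0 v" by simp
    qed
    then have fc: "f n o\<^sub>L c = 0" using M_reduced f c by blast
    have "f n (c v) = 0" for v
      using arg_cong[OF fc, of "\<lambda>q. blinfun_apply q v"] by simp
    then have "s n *\<^sub>R (q n (c v)) = 0" for v by (simp add: f_def blinfun.scaleR_left)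
    then have "q n o\<^sub>L c = 0" using s[of n] by (intro blinfun_eqI) simp
    then show False using qc by blast
  qed
  \<comment> \<open>The size of the main term. It is stated through \<delta>(w) and not through a
    numerator, because the common denominator chosen below varies with n.\<close>
  define \<nu> where "\<nu> n = N (strong_mult (of_bounded (f n o\<^sub>L f n)) (\<delta> w))" for n
  \<comment> \<open>Collects the values of \<delta> at \<open>f n\<close> and its square, which are
    fixed before the exponent is chosen; the 1 makes it positive and also covers the term with
    \<delta>(z).\<close>
  define R where "R n = 1 + N (\<delta> (f n)) + N (\<delta> (f n o\<^sub>L f n))" for n
  have Nf: "0 \<le> N (\<delta> (f n))" "0 \<le> N (\<delta> (f n o\<^sub>L f n))" for n
    using N_nonneg \<delta>_in f M_compose by auto
  have "0 < \<nu> n" for n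
  proof -
    have "frac b ((f n o\<^sub>L f n) o\<^sub>L c) \<in> E"
      using E_mult(1)[OF b c M_compose[OF f f]] \<delta>_in[OF wM] \<delta>w by metis
    then show ?thesis
      using N_pos[OF b _ ffc[of n]] f c unfolding \<nu>_def \<delta>w
      by (simp add: strong_mult_left_frac b M_compose)
  qed
  \<comment> \<open>The exponent has to beat the error \<open>R n\<close> by the factor n; this is
    possible since the main term is nonzero.\<close>
  then have "\<exists>k. real n * R n < real k * \<nu> n" for n
    using reals_Archimedean3 by blast
  then obtain k where k: "\<And>n. real n * R n < real (k n) * \<nu> n" by metis
  define g where "g n = f n o\<^sub>L opow w (Suc (k n))" for n
  have gM: "g n \<in> M" for n unfolding g_def by (intro M_compose f M_opow wM)
  have ng: "norm (g n) \<le> (1/2)^n" for n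
  proof -
    have "norm (g n) \<le> norm (f n) * norm (opow w (Suc (k n)))"
      unfolding g_def by (rule norm_blinfun_compose)
    also have "\<dots> \<le> (1/2)^n * 1"
      by (intro mult_mono nf norm_opow_le w') simp_all
    finally show ?thesis by simp
  qed
  have "summable g"
    by (rule summable_comparison_test'[of "\<lambda>n. (1/2)^n" 0]) (use ng in \<open>auto intro: summable_geometric\<close>)
  define z where "z = suminf g"
  have gz: "g sums z" using \<open>summable g\<close> unfolding z_def by (rule summable_sums)
  have z: "z \<in> M"
  proof (rule closed_sequentially[OF M_closed])
    show "(\<Sum>i<n. g i) \<in> M" for n by (induction n) (simp_all add: gM M_add)
    show "(\<lambda>n. \<Sum>i<n. g i) \<longlonglongrightarrow> z" using gz by (simp add: sums_def)
  qed
  \<comment> \<open>By disjointness only the n-th summand survives, so the limit defining z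
    disappears before \<delta> is applied.\<close>
  have fz: "f n o\<^sub>L z = (f n o\<^sub>L f n) o\<^sub>L opow w (Suc (k n))" for n
  proof -
    have "(\<lambda>m. f n o\<^sub>L g m) sums (f n o\<^sub>L z)"
      by (rule bounded_linear.sums[OF bounded_bilinear.bounded_linear_right[OF
            bounded_bilinear_blinfun_compose] gz])
    moreover have "(\<lambda>m. f n o\<^sub>L g m) = (\<lambda>m. if m = n then f m o\<^sub>L g m else 0)"
    proof
      fix m
      have "f n o\<^sub>L g m = 0" if "m \<noteq> n"
        using fdisj[of n m] that by (intro blinfun_eqI) (simp add: g_def)
      then show "f n o\<^sub>L g m = (if m = n then f m o\<^sub>L g m else 0)" by simp
    qed
    ultimately have "f n o\<^sub>L z = f n o\<^sub>L g n"
      using sums_unique2 sums_single[of n "\<lambda>m. f m o\<^sub>L g m"] by metis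
    then show ?thesis by (simp add: g_def blinfun_compose_assoc)
  qed
  define C where "C = norm z + N (\<delta> z) + 1"
  have Nz: "0 \<le> N (\<delta> z)" using N_nonneg \<delta>_in z by blast
  have "real n < C" for n
  proof -
    let ?ff = "f n o\<^sub>L f n" and ?K = "k n"
    let ?P = "opow w (Suc ?K)" and ?Q = "opow w ?K" and ?Q' = "opow w' ?K"
    have ffM: "?ff \<in> M" and PM: "?P \<in> M" and QM: "?Q \<in> M" and QM': "?Q' \<in> M"
      using f wM w' by (simp_all only: M_compose M_opow)
    have "\<exists>B\<in>denominators. \<forall>x\<in>{\<delta> w, \<delta> z, \<delta> (f n), \<delta> ?ff}. \<exists>c\<in>M. x = frac B c"
      by (rule common_denominator) (use \<delta>_in wM z f ffM in auto)
    then obtain B c' d e h where B: "B \<in> denominators"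
      and M: "c' \<in> M" "d \<in> M" "e \<in> M" "h \<in> M"
      and fr: "\<delta> w = frac B c'" "\<delta> z = frac B d" "\<delta> (f n) = frac B e" "\<delta> ?ff = frac B h"
      by auto
    have inE: "frac B c' \<in> E" "frac B d \<in> E" "frac B e \<in> E" "frac B h \<in> E"
      using \<delta>_in wM z f ffM by (simp_all flip: fr)
    let ?kc = "real (Suc ?K) *\<^sub>R (?Q o\<^sub>L c')"
    have kcM: "?kc \<in> M" using QM M by (simp only: M_scaleR M_compose)
    \<comment> \<open>\<delta> of the element in \<open>fz\<close>, computed by the Leibniz rule
      from each of its two factorizations.\<close>
    have "frac B ((z o\<^sub>L e) + (f n o\<^sub>L d)) = frac B ((?P o\<^sub>L h) + (?ff o\<^sub>L ?kc))"
      using \<delta>_mult[OF B M(3,2) f z fr(3,2)]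
        \<delta>_mult[OF B M(4) kcM ffM PM fr(4) \<delta>_opow[OF B M(1) wM fr(1)]] fz[of n] by metis
    then have eq: "(z o\<^sub>L e) + (f n o\<^sub>L d) = (?P o\<^sub>L h) + (?ff o\<^sub>L ?kc)"
      using frac_inject[OF B] M z f PM ffM kcM by (metis M_add M_compose)
    have inv: "?Q' (?Q v) = v" for v
    proof -
      have "opow w' j (opow w j v) = v" for j v
      proof (induction j arbitrary: v)
        case (Suc j)
        have "w' (opow w' j (w (opow w j v))) = w (w' (opow w' j (opow w j v)))"
          by (simp add: M_commute[OF M_opow[OF w'(1)] wM] M_commute[OF w'(1) wM])
        then show ?case
          using Suc arg_cong[OF w'(2), of "\<lambda>q. blinfun_apply q v"] by simp
      qed simp
      then show ?thesis .
    qed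
    \<comment> \<open>The power of w' cancels w^k in the main term, and being a contraction it does
      not enlarge the norm of the other side.\<close>
    let ?r = "?Q' o\<^sub>L ((z o\<^sub>L e) + (f n o\<^sub>L d) - (?P o\<^sub>L h))"
    have "?r = ?Q' o\<^sub>L (?ff o\<^sub>L ?kc)" unfolding eq by simp
    also have "\<dots> = scaleC_blinfun (complex_of_real (real (Suc ?K))) (?ff o\<^sub>L c')"
    proof (rule blinfun_eqI)
      fix v
      have "f n (f n (?Q (c' v))) = ?Q (f n (f n (c' v)))"
        by (simp add: M_commute[OF QM f])
      then show "(?Q' o\<^sub>L (?ff o\<^sub>L ?kc)) v
          = scaleC_blinfun (complex_of_real (real (Suc ?K))) (?ff o\<^sub>L c') v"
        unfolding scaleC_of_real_blinfun by (simp add: blinfun.bilinear_simps inv del: of_nat_Suc)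
    qed
    finally have r: "?r = scaleC_blinfun (complex_of_real (real (Suc ?K))) (?ff o\<^sub>L c')" .
    have ze: "frac B (z o\<^sub>L e) \<in> E" "N (frac B (z o\<^sub>L e)) \<le> norm z * N (frac B e)"
      by (rule E_mult[OF B M(3) z inE(3)])+
    have fd: "frac B (f n o\<^sub>L d) \<in> E" "N (frac B (f n o\<^sub>L d)) \<le> norm (f n) * N (frac B d)"
      by (rule E_mult[OF B M(2) f inE(2)])+
    have Ph: "frac B (?P o\<^sub>L h) \<in> E" "N (frac B (?P o\<^sub>L h)) \<le> norm ?P * N (frac B h)"
      by (rule E_mult[OF B M(4) PM inE(4)])+
    have sm: "frac B ((z o\<^sub>L e) + (f n o\<^sub>L d)) \<in> E"
        "N (frac B ((z o\<^sub>L e) + (f n o\<^sub>L d))) \<le> N (frac B (z o\<^sub>L e)) + N (frac B (f n o\<^sub>L d))"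
      by (rule E_add[OF B M_compose[OF z M(3)] M_compose[OF f M(2)] ze(1) fd(1)])+
    have df: "frac B ((z o\<^sub>L e) + (f n o\<^sub>L d) - (?P o\<^sub>L h)) \<in> E"
        "N (frac B ((z o\<^sub>L e) + (f n o\<^sub>L d) - (?P o\<^sub>L h)))
          \<le> N (frac B ((z o\<^sub>L e) + (f n o\<^sub>L d))) + N (frac B (?P o\<^sub>L h))"
      by (rule E_diff[OF B M_add[OF M_compose[OF z M(3)] M_compose[OF f M(2)]]
            M_compose[OF PM M(4)] sm(1) Ph(1)])+
    have dM: "(z o\<^sub>L e) + (f n o\<^sub>L d) - (?P o\<^sub>L h) \<in> M"
      by (intro M_diff M_add M_compose z f PM M)
    have "real n * R n < real ?K * \<nu> n" by (rule k)
    also have "\<dots> \<le> real (Suc ?K) * \<nu> n"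
      using \<open>0 < \<nu> n\<close> by (intro mult_right_mono) simp_all
    also have "\<dots> = N (frac B ?r)"
    proof -
      have "\<nu> n = N (frac B (?ff o\<^sub>L c'))"
        by (simp add: \<nu>_def fr(1) strong_mult_left_frac[OF B M(1) ffM])
      moreover have "frac B (?ff o\<^sub>L c') \<in> E" by (rule E_mult[OF B M(1) ffM inE(1)])
      ultimately show ?thesis
        unfolding r using E_scale(2)[OF B M_compose[OF ffM M(1)]] by (simp del: of_nat_Suc)
    qed
    also have "\<dots> \<le> norm ?Q' * N (frac B ((z o\<^sub>L e) + (f n o\<^sub>L d) - (?P o\<^sub>L h)))"
      by (rule E_mult(2)[OF B dM QM' df(1)])
    also have "\<dots> \<le> 1 * N (frac B ((z o\<^sub>L e) + (f n o\<^sub>L d) - (?P o\<^sub>L h)))"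
      by (intro mult_right_mono norm_opow_le w' N_nonneg df)
    also have "\<dots> \<le> norm z * N (\<delta> (f n)) + norm (f n) * N (\<delta> z) + norm ?P * N (\<delta> ?ff)"
      using df(2) sm(2) ze(2) fd(2) Ph(2) by (simp only: fr mult_1)
    also have "\<dots> \<le> norm z * N (\<delta> (f n)) + 1 * N (\<delta> z) + 1 * N (\<delta> ?ff)"
    proof -
      have "norm (f n) \<le> 1" using nf[of n] power_le_one[of "1/2 :: real" n] by simp
      moreover have "norm ?P \<le> 1" by (rule norm_opow_le[OF w'(3)])
      ultimately show ?thesis using Nz Nf by (intro add_mono mult_right_mono order_refl) auto
    qed
    also have "\<dots> \<le> C * R n"
    proof -
      \<comment> \<open>All three subtracted terms occur in the expanded product, whose remaining
        terms are nonnegative.\<close>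
      have "0 \<le> (norm z + N (\<delta> z) + 1) * (1 + N (\<delta> (f n)) + N (\<delta> ?ff))
          - (norm z * N (\<delta> (f n)) + N (\<delta> z) + N (\<delta> ?ff))"
        using Nz Nf[of n] by (simp add: algebra_simps)
      then show ?thesis by (simp add: C_def R_def)
    qed
    finally have "real n * R n < C * R n" .
    moreover have "0 < R n" using Nf[of n] by (simp add: R_def)
    ultimately show ?thesis by (simp add: mult_less_cancel_right)
  qed
  then show False using reals_Archimedean2[of C] by (meson less_asym)
qed

text \<open>If c were nonzero, every nonzero a c could be split by a disjoint pair. Splitting
  forever, with one half cut off each time and the other split again, gives an infinite disjoint
  sequence.\<close>

lemma \<delta>_unitary:
  assumes w: "w \<in> unitaries"
  shows "\<delta> w = of_bounded 0"
proof -
  have wM: "w \<in> M" using w by (simp add: unitaries_def)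
  obtain b c where b: "b \<in> denominators" and c: "c \<in> M" and \<delta>w: "\<delta> w = frac b c"
    using E_frac[OF \<delta>_in[OF wM]] by blast
  have "c = 0"
  proof (rule ccontr)
    assume c0: "c \<noteq> 0"
    \<comment> \<open>Without a splitting, a c would satisfy \<open>indec\<close>; w would be a
      scalar on its range, forcing a c = 0.\<close>
    have split: "\<exists>f g. f \<in> M \<and> g \<in> M \<and> f o\<^sub>L g = 0 \<and> f o\<^sub>L (a o\<^sub>L c) \<noteq> 0 \<and> g o\<^sub>L (a o\<^sub>L c) \<noteq> 0"
      if a: "a \<in> M" "a o\<^sub>L c \<noteq> 0" for a
    proof (rule ccontr)
      assume "\<not> ?thesis"
      then obtain z where "(w - scaleC_blinfun z id_blinfun) o\<^sub>L (a o\<^sub>L c) = 0"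
        using scalar_on_range[OF M_compose[OF a(1) c] wM] by blast
      then show False using numerator_vanishes_if_scalar[OF b c wM \<delta>w a(1)] a(2) by blast
    qed
    define good where "good a \<longleftrightarrow> a \<in> M \<and> a o\<^sub>L c \<noteq> 0" for a
    obtain F G where FG: "\<And>a. good a \<Longrightarrow> F a \<in> M \<and> G a \<in> M \<and> F a o\<^sub>L G a = 0 \<and>
        F a o\<^sub>L (a o\<^sub>L c) \<noteq> 0 \<and> G a o\<^sub>L (a o\<^sub>L c) \<noteq> 0"
      using split unfolding good_def by metis
    \<comment> \<open>A n is the part still to be split; G continues, while F is cut off to form
      \<open>q n\<close>.\<close>
    define A where "A = rec_nat id_blinfun (\<lambda>_ a. G a o\<^sub>L a)"
    have A0: "A 0 = id_blinfun" and AS: "\<And>n. A (Suc n) = G (A n) o\<^sub>L A n"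
      by (simp_all add: A_def)
    have good: "good (A n)" for n
    proof (induction n)
      case (Suc n)
      then show ?case using FG[of "A n"] by (auto simp: good_def AS blinfun_compose_assoc)
    qed (simp add: A0 good_def c0)
    then have AM: "A n \<in> M" for n by (simp add: good_def)
    define q where "q n = F (A n) o\<^sub>L A n" for n
    have qM: "q n \<in> M" for n using FG[OF good] AM by (simp add: q_def M_compose)
    have qc: "q n o\<^sub>L c \<noteq> 0" for n using FG[OF good[of n]] by (simp add: q_def blinfun_compose_assoc)
    \<comment> \<open>Every later A contains the factor \<open>G (A n)\<close>, which annihilates
      the factor \<open>F (A n)\<close> of \<open>q n\<close>; this yields the disjointness.\<close>
    have later: "\<exists>t\<in>M. A (Suc n + j) = t o\<^sub>L A (Suc n)" for n j
    proof (induction j)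
      case 0
      show ?case by (rule bexI[of _ id_blinfun]) simp_all
    next
      case (Suc j)
      then obtain t where t: "t \<in> M" "A (Suc n + j) = t o\<^sub>L A (Suc n)" by blast
      have "A (Suc n + Suc j) = G (A (Suc n + j)) o\<^sub>L A (Suc n + j)"
        by (simp only: AS add_Suc_right)
      also have "\<dots> = (G (A (Suc n + j)) o\<^sub>L t) o\<^sub>L A (Suc n)"
        using t(2) by (simp only: blinfun_compose_assoc)
      finally show ?case using FG[OF good[of "Suc n + j"]] t(1) M_compose by blast
    qed
    have q0: "q m o\<^sub>L q n = 0" if nm: "n < m" for m n
    proof -
      obtain t where t: "t \<in> M" "A m = t o\<^sub>L A (Suc n)"
        using later[of n "m - Suc n"] nm by auto
      have FM: "F (A m) \<in> M" "F (A n) \<in> M" "G (A n) \<in> M" using FG good by blast+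
      have FG0: "F (A n) o\<^sub>L G (A n) = 0" using FG good by blast
      have "G (A n) (F (A n) v) = 0" for v
        using arg_cong[OF FG0, of "\<lambda>q. blinfun_apply q v"]
          M_commute[OF FM(3,2), of v] by simp
      then show ?thesis
        by (intro blinfun_eqI)
          (simp add: q_def t(2) AS M_commute[OF AM[of n] FM(2)] blinfun.zero_right)
    qed
    have "q m o\<^sub>L q n = 0" if "m \<noteq> n" for m n
      using q0[of m n] q0[of n m] M_compose_commute[OF qM qM, of m n] that by (metis nat_neq_iff)
    then show False using no_disjoint_sequence[OF w b c \<delta>w qM _ qc] by blast
  qed
  then show ?thesis using \<delta>w of_bounded_0_eq_frac[OF b] by simp
qed

section \<open>From unitaries to the whole algebra\<close>

lemma \<delta>_eq_0_add:
  assumes "u \<in> M" "w \<in> M" "\<delta> u = of_bounded 0" "\<delta> w = of_bounded 0"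
  shows "\<delta> (u + w) = of_bounded 0"
  using \<delta>_add[OF denominators_id M_zero M_zero assms(1,2)] assms(3,4)
  by (simp add: of_bounded_0_eq_frac[OF denominators_id])

lemma \<delta>_eq_0_scale:
  assumes "u \<in> M" "\<delta> u = of_bounded 0"
  shows "\<delta> (scaleC_blinfun k u) = of_bounded 0"
proof -
  have "scaleC_blinfun k 0 = (0 :: 'a \<Rightarrow>\<^sub>L 'a)" by (rule blinfun_eqI) simp
  then show ?thesis
    using \<delta>_scale[OF denominators_id M_zero assms(1)] assms(2)
    by (simp add: of_bounded_0_eq_frac[OF denominators_id])
qed

lemma \<delta>_self_adjoint:
  assumes h: "h \<in> M" "is_adjoint h h"
  shows "\<delta> h = of_bounded 0"
proof -
  define r where "r = norm h + 1"
  have r: "0 < r" by (simp add: r_def add_nonneg_pos)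
  define u where "u = (1 / r) *\<^sub>R h"
  have u: "u \<in> M" "is_adjoint u u" using h by (simp_all add: u_def M_scaleR is_adjoint_scaleR_self)
  have "norm u = norm h / r" using r by (simp add: u_def)
  then have "norm u \<le> 1" using r by (simp add: r_def)
  then obtain w w' where "w \<in> unitaries" "w' \<in> unitaries" "u = scaleC_blinfun (1/2) (w + w')"
    using self_adjoint_eq_unitaries u by blast
  moreover from this have "\<delta> (w + w') = of_bounded 0" "w + w' \<in> M"
    using \<delta>_eq_0_add \<delta>_unitary by (auto simp: unitaries_def)
  ultimately have "\<delta> u = of_bounded 0" using \<delta>_eq_0_scale by metis
  moreover have "h = scaleC_blinfun (complex_of_real r) u"
    using r by (simp add: u_def scaleC_of_real_blinfun)
  ultimately show ?thesis using \<delta>_eq_0_scale u(1) by metis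
qed

lemma derivation_eq_0:
  assumes "u \<in> M"
  shows "\<delta> u = of_bounded 0"
proof -
  obtain h k where hk: "h \<in> M" "k \<in> M" "is_adjoint h h" "is_adjoint k k"
    "u = h + scaleC_blinfun \<i> k"
    using self_adjoint_parts[OF assms] by blast
  then show ?thesis
    using \<delta>_self_adjoint \<delta>_eq_0_scale \<delta>_eq_0_add M_scaleC by simp
qed

end

theorem corollary15:
  fixes M :: "('a::chilbert_space \<Rightarrow>\<^sub>L 'a) set"
    and \<tau> :: "('a \<Rightarrow>\<^sub>L 'a) \<Rightarrow> ennreal"
    and E :: "'a operator set"
    and N :: "'a operator \<Rightarrow> real"
    and \<delta> :: "('a \<Rightarrow>\<^sub>L 'a) \<Rightarrow> 'a operator"
  assumes "von_neumann_algebra M" and "commutative_ops M"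
    and "trace_on M \<tau>" and "faithful_on M \<tau>" and "normal_on M \<tau>" and "semifinite_on M \<tau>"
    and "banach_bimodule_of_compact M \<tau> E N"
    and "derivation M E \<delta>"
  shows "\<forall>u\<in>M. \<delta> u = of_bounded 0"
proof -
  interpret bimodule_derivation M \<tau> E N \<delta>
    by unfold_locales (use assms in \<open>simp_all add: banach_bimodule_of_compact_def\<close>)
  show ?thesis using derivation_eq_0 by blast
qed

end
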